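(* Let $X=\ell^p(\mathbb{N}_0)$ ($1\le p<\infty$) or $X=c_0(\mathbb{N}_0)$, let $n,m\in\mathbb{N}$, and let $a_{i,j}$ be constants with associated polynomials $p_i(z)=-\sum_{j=0}^m a_{i-1,j}z^j$ ($i=1,\dots,n$) and $q(z)=1+\sum_{j=1}^m a_{n,j}z^j$. Then for any $h>0$ such that $\{z\in\mathbb{C}:q(z)=0\}\subset\mathbb{C}\setminus\overline{B(1/h,1/h)}$, the semigroup $(e^{tA_h^-})_{t\ge0}$ generated by $$A_h^-=\begin{pmatrix}0&I&0&\dots\\0&0&I&\dots\\ \vdots&\vdots&\vdots&\ddots\\ (p_1/q)(\Delta_h^-)&(p_2/q)(\Delta_h^-)&\dots&(p_n/q)(\Delta_h^-)\end{pmatrix}$$ fails to be Devaney chaotic on $X^n$.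
   Context: $B(c,r)$ is the open disc in $\mathbb{C}$ with center $c$ and radius $r$. The backward difference operator on $X$ is $\Delta_h^-=\frac{I-F}{h}$, where $F$ is the forward shift $F(x_0,x_1,\dots)=(0,x_0,x_1,\dots)$; $\sigma(\Delta_h^-)=\overline{B(1/h,1/h)}$, and $(p_i/q)(\Delta_h^-)$ is defined by the Riesz–Dunford functional calculus. The system $\partial_t(u_1,\dots,u_n)^T=A_h^-(u_1,\dots,u_n)^T$ is the backward semidiscretization in space, with step $h$, of the PDE $\partial_t^nu+\sum_{j=1}^m a_{n,j}\partial_t^n\partial_x^ju+\sum_{0\le i<n,0\le j\le m}a_{i,j}\partial_t^i\partial_x^ju=0$ (the case without mixed derivatives in the highest-order time term is $q\equiv1$). A $C_0$-semigroup $(T_t)$ is Devaney chaotic if $\{T_tx:t\ge0\}$ is dense for some $x$ and the set of $x$ with $T_tx=x$ for some $t>0$ is dense. *)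

theory Defs
  imports "HOL-Complex_Analysis.Complex_Analysis"
begin

section \<open>Complex sequence spaces\<close>

text \<open>A sequence space is a pair of a carrier \<open>X\<close> and a norm \<open>N\<close>, since the exponent of
  \<open>\<ell>\<^sup>p\<close> cannot be a parameter of a type. Only the values of \<open>N\<close> on \<open>X\<close> matter.\<close>

type_synonym cseq = "nat \<Rightarrow> complex"

definition lp_space :: "real \<Rightarrow> cseq set" where
  "lp_space p = {x. summable (\<lambda>k. norm (x k) powr p)}"

definition lp_norm :: "real \<Rightarrow> cseq \<Rightarrow> real" where
  "lp_norm p x = (\<Sum>k. norm (x k) powr p) powr (1 / p)"

definition c0_space :: "cseq set" where
  "c0_space = {x. x \<longlonglongrightarrow> 0}"

definition c0_norm :: "cseq \<Rightarrow> real" where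
  "c0_norm x = (SUP k. norm (x k))"

text \<open>The value 0 off the carrier is there because the locale \<open>Metric_space\<close> requires
  nonnegative distances also outside the carrier.\<close>

definition seq_dist :: "cseq set \<Rightarrow> (cseq \<Rightarrow> real) \<Rightarrow> cseq \<Rightarrow> cseq \<Rightarrow> real" where
  "seq_dist X N x y = (if x \<in> X \<and> y \<in> X then N (\<lambda>k. x k - y k) else 0)"

definition seq_topology :: "cseq set \<Rightarrow> (cseq \<Rightarrow> real) \<Rightarrow> cseq topology" where
  "seq_topology X N = Metric_space.mtopology X (seq_dist X N)"

text \<open>\<open>X\<^sup>n\<close> with coordinates numbered from 1; its carrier is \<open>{1..n} \<rightarrow>\<^sub>E X\<close>.\<close>

definition power_topology :: "nat \<Rightarrow> cseq set \<Rightarrow> (cseq \<Rightarrow> real) \<Rightarrow> (nat \<Rightarrow> cseq) topology" where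
  "power_topology n X N = product_topology (\<lambda>_. seq_topology X N) {1..n}"

section \<open>Bounded operators, spectrum and the Riesz--Dunford calculus\<close>

definition bounded_op :: "cseq set \<Rightarrow> (cseq \<Rightarrow> real) \<Rightarrow> (cseq \<Rightarrow> cseq) \<Rightarrow> bool" where
  "bounded_op X N T \<longleftrightarrow>
     (\<forall>x\<in>X. T x \<in> X) \<and>
     (\<forall>x\<in>X. \<forall>y\<in>X. T (\<lambda>k. x k + y k) = (\<lambda>k. T x k + T y k)) \<and>
     (\<forall>c. \<forall>x\<in>X. T (\<lambda>k. c * x k) = (\<lambda>k. c * T x k)) \<and>
     (\<exists>M. \<forall>x\<in>X. N (T x) \<le> M * N x)"

definition shifted_op :: "(cseq \<Rightarrow> cseq) \<Rightarrow> complex \<Rightarrow> cseq \<Rightarrow> cseq" where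
  "shifted_op T z x = (\<lambda>k. z * x k - T x k)"

definition spectrum_on :: "cseq set \<Rightarrow> (cseq \<Rightarrow> real) \<Rightarrow> (cseq \<Rightarrow> cseq) \<Rightarrow> complex set" where
  "spectrum_on X N T =
     {z. \<not> (\<exists>R. bounded_op X N R \<and>
               (\<forall>x\<in>X. R (shifted_op T z x) = x \<and> shifted_op T z (R x) = x))}"

definition resolvent_on :: "cseq set \<Rightarrow> (cseq \<Rightarrow> cseq) \<Rightarrow> complex \<Rightarrow> cseq \<Rightarrow> cseq" where
  "resolvent_on X T z = inv_into X (shifted_op T z)"

text \<open>Integral over \<open>{0..1}\<close> of a sequence-valued function: this is \<open>has_integral\<close> (convergence of
  the Riemann sums along \<open>division_filter\<close>) with the type-class norm replaced by \<open>N\<close>.\<close>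

definition has_seq_integral ::
    "cseq set \<Rightarrow> (cseq \<Rightarrow> real) \<Rightarrow> (real \<Rightarrow> cseq) \<Rightarrow> cseq \<Rightarrow> bool" where
  "has_seq_integral X N g y \<longleftrightarrow> y \<in> X \<and>
     ((\<lambda>D. N (\<lambda>k. (\<Sum>(t, K)\<in>D. complex_of_real (measure lborel K) * g t k) - y k)) \<longlongrightarrow> 0)
       (division_filter {0..1})"

definition has_seq_contour_integral ::
    "cseq set \<Rightarrow> (cseq \<Rightarrow> real) \<Rightarrow> (complex \<Rightarrow> cseq) \<Rightarrow> cseq \<Rightarrow> (real \<Rightarrow> complex) \<Rightarrow> bool" where
  "has_seq_contour_integral X N F y \<gamma> \<longleftrightarrow>
     has_seq_integral X N
       (\<lambda>t k. F (\<gamma> t) k * vector_derivative \<gamma> (at t within {0..1})) y"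

text \<open>The closed path \<open>\<gamma>\<close> surrounds the compact set \<open>K\<close> once inside the open set \<open>U\<close>. A single
  closed path, instead of a cycle, is enough for a connected spectrum such as the disc
  arising here.\<close>

definition surrounds_in :: "(real \<Rightarrow> complex) \<Rightarrow> complex set \<Rightarrow> complex set \<Rightarrow> bool" where
  "surrounds_in \<gamma> K U \<longleftrightarrow>
     valid_path \<gamma> \<and> pathfinish \<gamma> = pathstart \<gamma> \<and> path_image \<gamma> \<subseteq> U - K \<and>
     (\<forall>z\<in>K. winding_number \<gamma> z = 1) \<and> (\<forall>z. z \<notin> U \<longrightarrow> winding_number \<gamma> z = 0)"

text \<open>\<open>f(T) x = 1/(2\<pi>i) \<integral>\<^sub>\<gamma> f(z) (z - T)\<^sup>-\<^sup>1 x dz\<close> for \<open>f\<close> holomorphic on a neighbourhood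
  \<open>U\<close> of the spectrum; the value depends neither on \<open>U\<close> nor on \<open>\<gamma>\<close>.\<close>

definition riesz_dunford ::
    "cseq set \<Rightarrow> (cseq \<Rightarrow> real) \<Rightarrow> (complex \<Rightarrow> complex) \<Rightarrow> (cseq \<Rightarrow> cseq) \<Rightarrow> cseq \<Rightarrow> cseq" where
  "riesz_dunford X N f T x =
     (THE y. \<exists>U \<gamma>. open U \<and> spectrum_on X N T \<subseteq> U \<and> f holomorphic_on U \<and>
        surrounds_in \<gamma> (spectrum_on X N T) U \<and>
        has_seq_contour_integral X N
          (\<lambda>z k. f z * resolvent_on X T z x k / (2 * of_real pi * \<i>)) y \<gamma>)"

section \<open>The semidiscretized system\<close>

definition forward_shift :: "cseq \<Rightarrow> cseq" where
  "forward_shift x = (\<lambda>k. case k of 0 \<Rightarrow> 0 | Suc j \<Rightarrow> x j)"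

definition backward_diff :: "real \<Rightarrow> cseq \<Rightarrow> cseq" where
  "backward_diff h x = (\<lambda>k. (x k - forward_shift x k) / of_real h)"

definition p_poly :: "nat \<Rightarrow> (nat \<Rightarrow> nat \<Rightarrow> complex) \<Rightarrow> nat \<Rightarrow> complex poly" where
  "p_poly m a i = - (\<Sum>j=0..m. monom (a (i - 1) j) j)"

definition q_poly :: "nat \<Rightarrow> nat \<Rightarrow> (nat \<Rightarrow> nat \<Rightarrow> complex) \<Rightarrow> complex poly" where
  "q_poly n m a = 1 + (\<Sum>j=1..m. monom (a n j) j)"

definition A_minus ::
    "cseq set \<Rightarrow> (cseq \<Rightarrow> real) \<Rightarrow> nat \<Rightarrow> nat \<Rightarrow> (nat \<Rightarrow> nat \<Rightarrow> complex) \<Rightarrow> real \<Rightarrow>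
     (nat \<Rightarrow> cseq) \<Rightarrow> (nat \<Rightarrow> cseq)" where
  "A_minus X N n m a h u =
     (\<lambda>i\<in>{1..n}.
        if i < n then u (i + 1)
        else (\<lambda>k. \<Sum>j=1..n.
          riesz_dunford X N (\<lambda>z. poly (p_poly m a j) z / poly (q_poly n m a) z)
            (backward_diff h) (u j) k))"

text \<open>\<open>exp (t A) u\<close>, the sum of the exponential series in \<open>X\<^sup>n\<close>.\<close>

definition exp_semigroup ::
    "nat \<Rightarrow> cseq set \<Rightarrow> (cseq \<Rightarrow> real) \<Rightarrow> ((nat \<Rightarrow> cseq) \<Rightarrow> (nat \<Rightarrow> cseq)) \<Rightarrow>
     real \<Rightarrow> (nat \<Rightarrow> cseq) \<Rightarrow> (nat \<Rightarrow> cseq)" where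
  "exp_semigroup n X N A t u =
     (THE v. limitin (power_topology n X N)
        (\<lambda>K. \<lambda>i\<in>{1..n}. \<lambda>k. \<Sum>l<K. of_real (t ^ l / fact l) * (A ^^ l) u i k)
        v sequentially)"

section \<open>Devaney chaos\<close>

definition devaney_chaotic :: "'a topology \<Rightarrow> (real \<Rightarrow> 'a \<Rightarrow> 'a) \<Rightarrow> bool" where
  "devaney_chaotic Y T \<longleftrightarrow>
     (\<exists>x\<in>topspace Y. Y closure_of {T t x | t. 0 \<le> t} = topspace Y) \<and>
     Y closure_of {x \<in> topspace Y. \<exists>t>0. T t x = x} = topspace Y"

end

theory Submission
  imports Defs "HOL-Computational_Algebra.Fundamental_Theorem_Algebra"
begin

text \<open>
  The difference operator \<open>\<Delta> = (I - F) / h\<close> is lower triangular: the entry \<open>(\<Delta> x) 0\<close> is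
  \<open>x 0 / h\<close>. Hence \<open>(f(\<Delta>) x) 0 = f(1/h) \<cdot> x 0\<close> for every \<open>f\<close> holomorphic near the spectrum,
  and the zeroth entries \<open>(u\<^sub>1(0), \<dots>, u\<^sub>n(0))\<close> of a vector in \<open>X\<^sup>n\<close> evolve on their own,
  by a companion matrix on \<open>\<complex>\<^sup>n\<close>. A left eigenvector \<open>w\<close> of that matrix, with eigenvalue
  \<open>\<lambda>\<close>, gives a continuous surjective functional \<open>\<phi> u = \<Sum>i. w\<^sub>i u\<^sub>i(0)\<close> with
  \<open>\<phi> (e\<^sup>t\<^sup>A u) = e\<^sup>t\<^sup>\<lambda> \<phi> u\<close>. A dense orbit of the semigroup would make \<open>{e\<^sup>t\<^sup>\<lambda> z | t \<ge> 0}\<close>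
  dense in \<open>\<complex>\<close> for some \<open>z\<close>, but the modulus of \<open>e\<^sup>t\<^sup>\<lambda> z\<close> is monotone in \<open>t\<close>. So already the
  transitivity half of Devaney chaos fails.

  The work lies in the analytic objects involved. The contour integral defining \<open>f(\<Delta>) x\<close>
  must exist in the norm of \<open>X\<close> and have one value for all admissible contours. The resolvent
  of \<open>\<Delta>\<close> is convolution with an explicit kernel, so every entry of the integral is a finite
  combination of integrals of \<open>f(z) / (z - 1/h)\<^sup>j\<^sup>+\<^sup>1\<close>; by Cauchy's formula these are the Taylor
  coefficients of \<open>f\<close> at \<open>1/h\<close> (\<open>contour_integral_pole\<close>), whatever the contour. Therefore
  \<open>f(\<Delta>)\<close> is convolution with the coefficients of \<open>f((1 - s)/h)\<close> in powers of \<open>s\<close>. They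
  are absolutely summable since \<open>f\<close> is holomorphic beyond the closed disc, so that the
  convolution is bounded on \<open>X\<close>; dominated convergence in the coefficient index shows that
  the Riemann sums over a circle converge in norm (\<open>riesz_dunford_backward_diff\<close>).
  Consequently \<open>A\<close> is bounded, the exponential series converges, and applying \<open>\<phi>\<close> term by
  term is legitimate (\<open>exp_semigroup_eigenfunctional\<close>).

  Both kinds of sequence space enter only through a few properties, collected in the locale
  \<open>sequence_space\<close>.
\<close>

section \<open>Sequence spaces invariant under the forward shift\<close>

text \<open>The last assumption is completeness in the form in which it is used: the candidate for
  the limit is known entrywise, and the rate \<open>e\<close> of the Cauchy condition is inherited by the
  limit. It holds for both \<open>\<ell>\<^sup>p\<close> and \<open>c\<^sub>0\<close>; the simpler closure property, that bounded
  entrywise limits stay in the space, fails for \<open>c\<^sub>0\<close>.\<close>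

locale sequence_space =
  fixes X :: "cseq set" and N :: "cseq \<Rightarrow> real"
  assumes add_mem: "x \<in> X \<Longrightarrow> y \<in> X \<Longrightarrow> (\<lambda>k. x k + y k) \<in> X"
    and scale_mem: "x \<in> X \<Longrightarrow> (\<lambda>k. c * x k) \<in> X"
    and unit_mem: "(\<lambda>k. if k = 0 then 1 else 0) \<in> X"
    and shift_mem: "x \<in> X \<Longrightarrow> forward_shift x \<in> X"
    and norm_triangle: "x \<in> X \<Longrightarrow> y \<in> X \<Longrightarrow> N (\<lambda>k. x k + y k) \<le> N x + N y"
    and norm_scale: "x \<in> X \<Longrightarrow> N (\<lambda>k. c * x k) = norm c * N x"
    and norm_shift: "x \<in> X \<Longrightarrow> N (forward_shift x) \<le> N x"
    and coord_le: "x \<in> X \<Longrightarrow> norm (x k) \<le> N x"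
    and complete: "(\<And>j. s j \<in> X) \<Longrightarrow> (\<And>k. (\<lambda>j. s j k) \<longlonglongrightarrow> x k) \<Longrightarrow> e \<longlonglongrightarrow> 0 \<Longrightarrow>
      (\<And>i j. i \<le> j \<Longrightarrow> N (\<lambda>k. s j k - s i k) \<le> e i) \<Longrightarrow>
      x \<in> X \<and> (\<forall>i. N (\<lambda>k. x k - s i k) \<le> e i)"

text \<open>Membership in \<open>\<ell>\<^sup>p\<close> and the size of the norm are both controlled by finite partial sums,
  which are what survives an entrywise limit.\<close>

lemma lp_normI:
  assumes "p \<ge> 1" "A \<ge> 0" and b: "\<And>K. (\<Sum>k<K. norm (x k) powr p) \<le> A powr p"
  shows "x \<in> lp_space p" "lp_norm p x \<le> A"
proof -
  have s: "summable (\<lambda>k. norm (x k) powr p)"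
    by (rule summableI_nonneg_bounded[OF _ b]) auto
  then show "x \<in> lp_space p" by (simp add: lp_space_def)
  have "(\<Sum>k. norm (x k) powr p) \<le> A powr p"
    using s b by (rule suminf_le_const)
  then have "lp_norm p x \<le> (A powr p) powr (1/p)"
    unfolding lp_norm_def using assms s by (intro powr_mono2) (auto intro: suminf_nonneg)
  also have "\<dots> = A" using assms by (simp add: powr_powr)
  finally show "lp_norm p x \<le> A" .
qed

lemma lp_norm_sum_le:
  assumes "p \<ge> 1" "x \<in> lp_space p" "lp_norm p x \<le> A"
  shows "(\<Sum>k<K. norm (x k) powr p) \<le> A powr p"
proof -
  have s: "summable (\<lambda>k. norm (x k) powr p)" using assms by (simp add: lp_space_def)
  have "(\<Sum>k<K. norm (x k) powr p) \<le> (\<Sum>k. norm (x k) powr p)"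
    using s by (rule sum_le_suminf) auto
  also have "\<dots> = lp_norm p x powr p"
    using assms s by (simp add: lp_norm_def powr_powr suminf_nonneg)
  also have "\<dots> \<le> A powr p"
    using assms by (intro powr_mono2) (auto simp: lp_norm_def)
  finally show ?thesis .
qed

lemma lp_norm_scale:
  assumes "p \<ge> 1" "x \<in> lp_space p"
  shows "(\<lambda>k. c * x k) \<in> lp_space p" "lp_norm p (\<lambda>k. c * x k) = norm c * lp_norm p x"
proof -
  have s: "summable (\<lambda>k. norm (x k) powr p)" using assms by (simp add: lp_space_def)
  then show "(\<lambda>k. c * x k) \<in> lp_space p"
    using assms by (simp add: lp_space_def norm_mult powr_mult summable_mult)
  show "lp_norm p (\<lambda>k. c * x k) = norm c * lp_norm p x"
    using assms s
    by (simp add: lp_norm_def norm_mult powr_mult suminf_mult powr_powr suminf_nonneg)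
qed

lemma powr_convex_nonneg:
  fixes u v t p :: real
  assumes p: "p \<ge> 1" and t: "0 \<le> t" "t \<le> 1" and uv: "u \<ge> 0" "v \<ge> 0"
  shows "((1 - t) * u + t * v) powr p \<le> (1 - t) * u powr p + t * v powr p"
proof -
  have *: "(s * w) powr p \<le> s * w powr p" if "0 \<le> s" "s \<le> 1" "w \<ge> 0" for s w :: real
  proof -
    have "s powr p \<le> s powr 1" using that p by (intro powr_mono') auto
    then show ?thesis using that by (simp add: powr_mult mult_right_mono)
  qed
  show ?thesis
  proof (cases "u = 0 \<or> v = 0")
    case True
    then show ?thesis
    proof
      assume "u = 0" then show ?thesis using *[OF t uv(2)] by simp
    next
      assume "v = 0" then show ?thesis using *[of "1 - t" u] t uv by simp
    qed
  next
    case False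
    then show ?thesis using convex_onD[OF powr_convex[OF p] t, of u v] uv by simp
  qed
qed

text \<open>Minkowski's inequality, from convexity of \<open>t\<^sup>p\<close>: if \<open>A\<close> and \<open>B\<close> bound the two norms, then
  \<open>|x + y| / (A + B)\<close> is entrywise at most a convex combination of \<open>|x| / A\<close> and \<open>|y| / B\<close>, both of
  norm at most 1.\<close>

lemma lp_minkowski:
  assumes p: "p \<ge> 1" and x: "x \<in> lp_space p" and y: "y \<in> lp_space p"
  shows "(\<lambda>k. x k + y k) \<in> lp_space p"
    "lp_norm p (\<lambda>k. x k + y k) \<le> lp_norm p x + lp_norm p y"
proof -
  have nn: "lp_norm p z \<ge> 0" for z by (simp add: lp_norm_def)
  have key: "(\<lambda>k. x k + y k) \<in> lp_space p \<and> lp_norm p (\<lambda>k. x k + y k) \<le> lp_norm p x + lp_norm p y + e"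
    if e: "e > 0" for e
  proof -
    \<comment> \<open>the slack keeps both scales positive when one of the norms vanishes\<close>
    define A where "A = lp_norm p x + e/2"
    define B where "B = lp_norm p y + e/2"
    have AB: "A > 0" "B > 0" using nn[of x] nn[of y] e by (auto simp: A_def B_def)
    have pt: "norm (x k + y k) powr p \<le>
        (A+B) powr p * (A/(A+B) * (norm (x k) powr p / A powr p) + B/(A+B) * (norm (y k) powr p / B powr p))" for k
    proof -
      let ?t = "B/(A+B)"
      have t: "0 \<le> ?t" "?t \<le> 1" "1 - ?t = A/(A+B)" using AB by (auto simp: field_simps)
      have "norm (x k + y k) powr p \<le> (norm (x k) + norm (y k)) powr p"
        using p by (intro powr_mono2) (auto simp: norm_triangle_ineq)
      also have "norm (x k) + norm (y k) = (A+B) * ((1 - ?t) * (norm (x k) / A) + ?t * (norm (y k) / B))"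
      proof -
        have "(A+B) * (A/(A+B) * (norm (x k) / A)) = norm (x k)" "(A+B) * (B/(A+B) * (norm (y k) / B)) = norm (y k)"
          using AB by auto
        then show ?thesis unfolding t(3) distrib_left by simp
      qed
      also have "\<dots> powr p = (A+B) powr p * ((1 - ?t) * (norm (x k) / A) + ?t * (norm (y k) / B)) powr p"
        using AB t by (simp add: powr_mult)
      also have "\<dots> \<le> (A+B) powr p * ((1 - ?t) * (norm (x k) / A) powr p + ?t * (norm (y k) / B) powr p)"
        using AB by (intro mult_left_mono powr_convex_nonneg p t(1,2)) auto
      finally show ?thesis unfolding t(3) using AB by (simp add: powr_divide)
    qed
    have "(\<Sum>k<K. norm (x k + y k) powr p) \<le> (A+B) powr p" for K
    proof -
      have 1: "(\<Sum>k<K. norm (x k) powr p) / A powr p \<le> 1"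
        using lp_norm_sum_le[OF p x, of A K] e AB by (simp add: A_def)
      have 2: "(\<Sum>k<K. norm (y k) powr p) / B powr p \<le> 1"
        using lp_norm_sum_le[OF p y, of B K] e AB by (simp add: B_def)
      have "(\<Sum>k<K. norm (x k + y k) powr p) \<le>
        (\<Sum>k<K. (A+B) powr p * (A/(A+B) * (norm (x k) powr p / A powr p) + B/(A+B) * (norm (y k) powr p / B powr p)))"
        by (rule sum_mono) (rule pt)
      also have "\<dots> = (A+B) powr p * (A/(A+B) * ((\<Sum>k<K. norm (x k) powr p) / A powr p)
          + B/(A+B) * ((\<Sum>k<K. norm (y k) powr p) / B powr p))"
        by (simp only: sum.distrib sum_distrib_left sum_divide_distrib distrib_left)
      also have "\<dots> \<le> (A+B) powr p * (A/(A+B) * 1 + B/(A+B) * 1)"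
        using AB by (intro mult_left_mono add_mono 1 2) auto
      also have "\<dots> = (A+B) powr p" using AB by (simp flip: add_divide_distrib)
      finally show ?thesis .
    qed
    from lp_normI[OF p _ this] AB show ?thesis by (auto simp: A_def B_def)
  qed
  show "(\<lambda>k. x k + y k) \<in> lp_space p" using key[of 1] by simp
  show "lp_norm p (\<lambda>k. x k + y k) \<le> lp_norm p x + lp_norm p y"
    by (rule field_le_epsilon) (use key in blast)
qed

lemma sum_forward_shift:
  "(\<Sum>k<K. norm (forward_shift x k) powr p) = (\<Sum>k<K-1. norm (x k) powr p)"
proof (cases K)
  case (Suc j)
  then show ?thesis
    by (simp only: sum.lessThan_Suc_shift) (simp add: forward_shift_def)
qed simp

lemma sequence_space_lp:
  assumes p: "p \<ge> 1"
  shows "sequence_space (lp_space p) (lp_norm p)"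
proof
  have nn: "lp_norm p z \<ge> 0" for z by (simp add: lp_norm_def)
  have p0: "p > 0" using p by simp
  fix x assume x: "x \<in> lp_space p"
  have b: "(\<Sum>k<K. norm (forward_shift x k) powr p) \<le> lp_norm p x powr p" for K
    unfolding sum_forward_shift by (rule lp_norm_sum_le[OF p x]) simp
  show "forward_shift x \<in> lp_space p" "lp_norm p (forward_shift x) \<le> lp_norm p x"
    using lp_normI[OF p nn b] .
  show "norm (x k) \<le> lp_norm p x" for k
  proof -
    have "norm (x k) powr p \<le> (\<Sum>k<Suc k. norm (x k) powr p)"
      by (rule member_le_sum) auto
    also have "\<dots> \<le> lp_norm p x powr p" by (rule lp_norm_sum_le[OF p x]) simp
    finally show ?thesis
      using powr_less_mono2[OF p0 nn[of x], of "norm (x k)"] by linarith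
  qed
next
  show "(\<lambda>k. if k = 0 then 1 else 0) \<in> lp_space p"
  proof -
    have "(\<lambda>k. norm (if k = 0 then 1 else (0::complex)) powr p) = (\<lambda>k. if k = (0::nat) then 1 else 0)"
      by auto
    then show ?thesis unfolding lp_space_def mem_Collect_eq by (simp only: summable_single)
  qed
next
  have nn: "lp_norm p z \<ge> 0" for z by (simp add: lp_norm_def)
  fix s :: "nat \<Rightarrow> cseq" and x e
  assume s: "\<And>j. s j \<in> lp_space p" and lim: "\<And>k. (\<lambda>j. s j k) \<longlonglongrightarrow> x k" and "e \<longlonglongrightarrow> 0"
    and cau: "\<And>i j. i \<le> j \<Longrightarrow> lp_norm p (\<lambda>k. s j k - s i k) \<le> e i"
  have diff: "(\<lambda>k. s j k - s i k) \<in> lp_space p" for i j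
    using lp_minkowski(1)[OF p s[of j] lp_norm_scale(1)[OF p s[of i], of "-1"]] by simp
  have *: "(\<Sum>k<K. norm (x k - s i k) powr p) \<le> e i powr p" for i K
  proof (rule Lim_bounded)
    show "(\<lambda>j. \<Sum>k<K. norm (s j k - s i k) powr p) \<longlonglongrightarrow> (\<Sum>k<K. norm (x k - s i k) powr p)"
      using p by (intro tendsto_intros tendsto_powr2 lim) auto
    show "\<forall>n\<ge>i. (\<Sum>k<K. norm (s n k - s i k) powr p) \<le> e i powr p"
      using lp_norm_sum_le[OF p diff cau] by blast
  qed
  have e: "e i \<ge> 0" for i using cau[of i i] nn order_trans by blast
  have "x \<in> lp_space p"
    using lp_minkowski(1)[OF p lp_normI(1)[OF p e *, of 0] s[of 0]] by simp
  then show "x \<in> lp_space p \<and> (\<forall>i. lp_norm p (\<lambda>k. x k - s i k) \<le> e i)"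
    using lp_normI(2)[OF p e *] by blast
qed (use p lp_minkowski lp_norm_scale in auto)

lemma sequence_space_c0: "sequence_space c0_space c0_norm"
proof -
  have bdd: "bdd_above (range (\<lambda>k. norm (x k)))" if "x \<in> c0_space" for x
  proof -
    from that have "convergent x" by (auto simp: c0_space_def convergent_def)
    then have "Bseq x" by (rule convergent_imp_Bseq)
    then obtain K where "\<And>k. norm (x k) \<le> K" by (auto simp: Bseq_def)
    then show ?thesis by (auto simp: bdd_above_def)
  qed
  have le: "norm (x k) \<le> c0_norm x" if "x \<in> c0_space" for x k
    unfolding c0_norm_def by (rule cSUP_upper[OF _ bdd[OF that]]) simp
  have least: "c0_norm x \<le> B" if "\<And>k. norm (x k) \<le> B" for x B
    unfolding c0_norm_def by (rule cSUP_least) (use that in auto)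
  show ?thesis
  proof
    fix x y :: cseq and c assume x: "x \<in> c0_space" 
    show 1: "(\<lambda>k. c * x k) \<in> c0_space" for c
      using x by (auto simp: c0_space_def intro: tendsto_mult_right_zero)
    have L: "c0_norm (\<lambda>k. c * x k) \<le> norm c * c0_norm x" if "x \<in> c0_space" for c x
      by (rule least) (simp add: norm_mult mult_left_mono le[OF that])
    show "c0_norm (\<lambda>k. c * x k) = norm c * c0_norm x"
    proof (cases "c = 0")
      case True then show ?thesis by (simp add: c0_norm_def)
    next
      case False
      have "c0_norm x \<le> norm (1/c) * c0_norm (\<lambda>k. c * x k)"
        using L[OF 1, of "1/c" c] False by simp
      with False L[OF x, of c] show ?thesis by (simp add: norm_divide field_simps)
    qed
    show "norm (x k) \<le> c0_norm x" for k by (rule le[OF x])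
    have "(\<lambda>k. forward_shift x (Suc k)) \<longlonglongrightarrow> 0" using x by (simp add: forward_shift_def c0_space_def)
    then show "forward_shift x \<in> c0_space" by (simp add: c0_space_def LIMSEQ_imp_Suc)
    show "c0_norm (forward_shift x) \<le> c0_norm x"
    proof (rule least)
      fix k
      have "0 \<le> c0_norm x" using le[OF x, of 0] norm_ge_zero order_trans by blast
      then show "norm (forward_shift x k) \<le> c0_norm x"
        by (cases k) (auto simp: forward_shift_def le[OF x])
    qed
    assume y: "y \<in> c0_space"
    show "(\<lambda>k. x k + y k) \<in> c0_space"
      using x y by (auto simp: c0_space_def intro: tendsto_add_zero)
    show "c0_norm (\<lambda>k. x k + y k) \<le> c0_norm x + c0_norm y"
      by (rule least) (intro norm_triangle_mono le x y)
  next
    show "(\<lambda>k. if k = 0 then 1 else 0) \<in> c0_space"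
      unfolding c0_space_def mem_Collect_eq
      by (rule tendsto_eventually) (auto intro: eventually_sequentiallyI[of 1])
  next
    fix s :: "nat \<Rightarrow> cseq" and x e
    assume s: "\<And>j. s j \<in> c0_space" and lim: "\<And>k. (\<lambda>j. s j k) \<longlonglongrightarrow> x k" and e: "e \<longlonglongrightarrow> 0"
      and cau: "\<And>i j. i \<le> j \<Longrightarrow> c0_norm (\<lambda>k. s j k - s i k) \<le> e i"
    have diff: "(\<lambda>k. s j k - s i k) \<in> c0_space" for i j
      using s[of i] s[of j] tendsto_diff by (fastforce simp: c0_space_def)
    have *: "norm (x k - s i k) \<le> e i" for i k
    proof (rule Lim_bounded)
      show "(\<lambda>j. norm (s j k - s i k)) \<longlonglongrightarrow> norm (x k - s i k)" by (intro tendsto_intros lim)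
      show "\<forall>n\<ge>i. norm (s n k - s i k) \<le> e i" using le[OF diff] cau order_trans by blast
    qed
    have "x \<longlonglongrightarrow> 0"
    proof (rule tendstoI)
      fix r :: real assume "r > 0"
      then have "\<forall>\<^sub>F i in sequentially. e i < r/2" using e by (intro order_tendstoD) auto
      then obtain i where i: "e i < r/2" by (auto simp: eventually_sequentially)
      have "\<forall>\<^sub>F k in sequentially. dist (s i k) 0 < r/2"
        using s[of i] \<open>r > 0\<close> by (intro tendstoD) (auto simp: c0_space_def)
      then show "\<forall>\<^sub>F k in sequentially. dist (x k) 0 < r"
      proof eventually_elim
        case (elim k)
        have "norm (x k) \<le> norm (x k - s i k) + norm (s i k)"
          using norm_triangle_ineq[of "x k - s i k" "s i k"] by simp
        then show ?case using *[of k i] i elim by simp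
      qed
    qed
    then show "x \<in> c0_space \<and> (\<forall>i. c0_norm (\<lambda>k. x k - s i k) \<le> e i)"
      using least[OF *] by (auto simp: c0_space_def)
  qed
qed

section \<open>Normed-space consequences and absolutely convergent series\<close>

context sequence_space
begin

lemma zero_mem: "(\<lambda>k. 0) \<in> X"
  using scale_mem[OF unit_mem, of 0] by simp

lemma norm_zero: "N (\<lambda>k. 0) = 0"
  using norm_scale[OF unit_mem, of 0] by simp

lemma norm_nonneg: "x \<in> X \<Longrightarrow> 0 \<le> N x"
  using coord_le[of x 0] norm_ge_zero order_trans by blast

lemma diff_mem: "x \<in> X \<Longrightarrow> y \<in> X \<Longrightarrow> (\<lambda>k. x k - y k) \<in> X"
  using add_mem[OF _ scale_mem[of y "-1"]] by simp

lemma norm_diff_commute: "x \<in> X \<Longrightarrow> y \<in> X \<Longrightarrow> N (\<lambda>k. x k - y k) = N (\<lambda>k. y k - x k)"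
  using norm_scale[OF diff_mem, of x y "-1"] by simp

lemma sum_mem: "(\<And>j. j \<in> J \<Longrightarrow> v j \<in> X) \<Longrightarrow> (\<lambda>k. \<Sum>j\<in>J. v j k) \<in> X"
  by (induction J rule: infinite_finite_induct) (auto simp: zero_mem intro: add_mem)

lemma norm_sum_le:
  "(\<And>j. j \<in> J \<Longrightarrow> v j \<in> X) \<Longrightarrow> N (\<lambda>k. \<Sum>j\<in>J. v j k) \<le> (\<Sum>j\<in>J. N (v j))"
proof (induction J rule: infinite_finite_induct)
  case (insert a J)
  then show ?case
    using norm_triangle[OF _ sum_mem[of J v], of "v a"] by (auto intro: order_trans)
qed (simp_all add: norm_zero)

sublocale metric: Metric_space X "seq_dist X N"
proof
  fix x y
  show "0 \<le> seq_dist X N x y"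
    by (simp add: seq_dist_def norm_nonneg diff_mem)
  show "seq_dist X N x y = seq_dist X N y x"
    by (auto simp: seq_dist_def intro: norm_diff_commute)
  assume xy: "x \<in> X" "y \<in> X"
  show "(seq_dist X N x y = 0) = (x = y)"
  proof
    assume "seq_dist X N x y = 0"
    then have "norm (x k - y k) \<le> 0" for k
      using coord_le[OF diff_mem[OF xy], of k] xy by (simp add: seq_dist_def)
    then show "x = y" by auto
  qed (simp add: seq_dist_def norm_zero)
  fix z assume z: "z \<in> X"
  show "seq_dist X N x z \<le> seq_dist X N x y + seq_dist X N y z"
    using norm_triangle[OF diff_mem[OF xy] diff_mem[OF xy(2) z]] xy z by (simp add: seq_dist_def)
qed

lemma topspace_power: "topspace (power_topology n X N) = {1..n} \<rightarrow>\<^sub>E X"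
  by (simp add: power_topology_def seq_topology_def)

lemma Hausdorff_power: "Hausdorff_space (power_topology n X N)"
  by (simp add: power_topology_def seq_topology_def Hausdorff_space_product_topology
      metric.Hausdorff_space_mtopology)

lemma limitin_seq_topologyI:
  assumes "x \<in> X" "\<And>j. s j \<in> X" "(\<lambda>j. N (\<lambda>k. x k - s j k)) \<longlonglongrightarrow> 0"
  shows "limitin (seq_topology X N) s x sequentially"
  unfolding seq_topology_def metric.limitin_metric_dist_null
  using assms by (simp add: seq_dist_def norm_diff_commute)

lemma continuous_coord: "continuous_map (seq_topology X N) euclidean (\<lambda>x. x k)"
proof -
  have "continuous_map metric.mtopology Met_TC.mtopology (\<lambda>x. x k)"
    unfolding metric.metric_continuous_map[OF Met_TC.Metric_space_axioms]
  proof (intro conjI ballI allI impI)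
    fix x and e :: real assume "x \<in> X" "e > 0"
    then show "\<exists>d>0. \<forall>y. y \<in> X \<and> seq_dist X N x y < d \<longrightarrow> dist (x k) (y k) < e"
      using coord_le[OF diff_mem, of x _ k]
      by (intro exI[of _ e]) (auto simp: seq_dist_def dist_norm intro: le_less_trans)
  qed auto
  then show ?thesis by (simp add: seq_topology_def)
qed

text \<open>The tails \<open>\<Sum>l\<ge>i. b l\<close> serve as the rate in the completeness axiom. Convolution operators and
  the exponential series are both obtained as such sums.\<close>

lemma absolutely_convergent_series:
  assumes v: "\<And>j. v j \<in> X" and le: "\<And>j. N (v j) \<le> b j" and b: "summable b"
  obtains y where "y \<in> X" "\<And>k. (\<lambda>j. v j k) sums y k"
    "\<And>i. N (\<lambda>k. y k - (\<Sum>j<i. v j k)) \<le> (\<Sum>j. b (j + i))"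
proof -
  define s where "s i = (\<lambda>k. \<Sum>j<i. v j k)" for i
  have b0: "b j \<ge> 0" for j using norm_nonneg[OF v] le order_trans by blast
  have sums: "(\<lambda>j. v j k) sums (\<Sum>j. v j k)" for k
    by (intro summable_sums summable_comparison_test'[OF b] order_trans[OF coord_le[OF v] le])
  have cauchy: "N (\<lambda>k. s j k - s i k) \<le> (\<Sum>l. b (l + i))" if "i \<le> j" for i j
  proof -
    have "(\<lambda>k. s j k - s i k) = (\<lambda>k. \<Sum>l=i..<j. v l k)"
      using that by (auto simp: s_def lessThan_atLeast0 sum_diff_nat_ivl)
    then have "N (\<lambda>k. s j k - s i k) \<le> (\<Sum>l=i..<j. N (v l))"
      using norm_sum_le[of "{i..<j}" v] v by simp
    also have "\<dots> \<le> (\<Sum>l=i..<j. b l)" by (rule sum_mono) (rule le)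
    also have "\<dots> = (\<Sum>l<j-i. b (l + i))"
      using that sum.shift_bounds_nat_ivl[of b 0 i "j - i"] by (simp add: lessThan_atLeast0)
    also have "\<dots> \<le> (\<Sum>l. b (l + i))"
      using b b0 by (intro sum_le_suminf) (auto simp: summable_iff_shift)
    finally show ?thesis .
  qed
  have "(\<lambda>k. \<Sum>j. v j k) \<in> X \<and> (\<forall>i. N (\<lambda>k. (\<Sum>j. v j k) - s i k) \<le> (\<Sum>l. b (l + i)))"
  proof (rule complete)
    show "s j \<in> X" for j unfolding s_def by (intro sum_mem v)
    show "(\<lambda>j. s j k) \<longlonglongrightarrow> (\<Sum>j. v j k)" for k using sums[of k] by (simp add: s_def sums_def)
    show "(\<lambda>i. \<Sum>l. b (l + i)) \<longlonglongrightarrow> 0" by (rule suminf_exist_split2[OF b])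
  qed (rule cauchy)
  then show ?thesis using that[of "\<lambda>k. \<Sum>j. v j k"] sums by (simp add: s_def)
qed

end

section \<open>Convolution operators\<close>

definition convolution :: "(nat \<Rightarrow> complex) \<Rightarrow> cseq \<Rightarrow> cseq" where
  "convolution b x = (\<lambda>k. \<Sum>j\<le>k. b j * x (k - j))"

lemma forward_shift_funpow: "(forward_shift ^^ j) x k = (if j \<le> k then x (k - j) else 0)"
  by (induction j arbitrary: k) (auto simp: forward_shift_def split: nat.split)

text \<open>Young's inequality: the convolution is the absolutely convergent series \<open>\<Sum>j. b\<^sub>j F\<^sup>j x\<close>,
  and the shift \<open>F\<close> does not increase the norm.\<close>

lemma (in sequence_space) convolution_mem_norm:
  assumes b: "summable (\<lambda>j. norm (b j))" and x: "x \<in> X"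
  shows "convolution b x \<in> X" "N (convolution b x) \<le> (\<Sum>j. norm (b j)) * N x"
proof -
  define v where "v j = (\<lambda>k. b j * (forward_shift ^^ j) x k)" for j
  have F: "(forward_shift ^^ j) x \<in> X \<and> N ((forward_shift ^^ j) x) \<le> N x" for j
    by (induction j) (auto simp: x intro: shift_mem order_trans[OF norm_shift])
  have v: "v j \<in> X" for j unfolding v_def using F by (intro scale_mem) auto
  have le: "N (v j) \<le> norm (b j) * N x" for j
    unfolding v_def using F[of j] by (auto simp: norm_scale mult_left_mono)
  have "summable (\<lambda>j. norm (b j) * N x)" using b by (rule summable_mult2)
  from absolutely_convergent_series[OF v le this] obtain y where
    y: "y \<in> X" "\<And>k. (\<lambda>j. v j k) sums y k"
      "\<And>i. N (\<lambda>k. y k - (\<Sum>j<i. v j k)) \<le> (\<Sum>j. norm (b (j + i)) * N x)" by blast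
  have "y = convolution b x"
  proof
    fix k
    have "(\<lambda>j. v j k) sums (\<Sum>j\<le>k. v j k)"
      by (rule sums_finite) (auto simp: v_def forward_shift_funpow)
    also have "(\<Sum>j\<le>k. v j k) = convolution b x k"
      by (simp add: convolution_def v_def forward_shift_funpow)
    finally show "y k = convolution b x k" using y(2) sums_unique2 by blast
  qed
  with y(1) y(3)[of 0] show "convolution b x \<in> X" "N (convolution b x) \<le> (\<Sum>j. norm (b j)) * N x"
    by (simp_all add: suminf_mult2[OF b])
qed

section \<open>Contour integrals around a pole of higher order\<close>

definition divided_diff :: "complex \<Rightarrow> (complex \<Rightarrow> complex) \<Rightarrow> complex \<Rightarrow> complex" where
  "divided_diff c f = (\<lambda>z. if z = c then deriv f c else (f z - f c) / (z - c))"

text \<open>The iterated divided difference \<open>(divided_diff c ^^ j) f c\<close> is the Taylor coefficient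
  \<open>f\<^sup>(\<^sup>j\<^sup>)(c) / j!\<close>. In this form the higher Cauchy formula for arbitrary closed paths follows
  from the one for simple poles: writing \<open>f z = f c + (z - c) g z\<close> lowers the order of the pole
  by one, and the remaining term \<open>f c / (z - c)\<^sup>j\<^sup>+\<^sup>2\<close> has a primitive.\<close>

lemma contour_integral_pole:
  assumes U: "open U" "c \<in> U" and f: "f holomorphic_on U"
    and \<gamma>: "valid_path \<gamma>" "pathfinish \<gamma> = pathstart \<gamma>" "path_image \<gamma> \<subseteq> U - {c}"
    and w: "winding_number \<gamma> c = 1" "\<And>z. z \<notin> U \<Longrightarrow> winding_number \<gamma> z = 0"
  shows "((\<lambda>z. f z / (z - c) ^ Suc j) has_contour_integral
      2 * of_real pi * \<i> * (divided_diff c ^^ j) f c) \<gamma>"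
  using f
proof (induction j arbitrary: f)
  case 0
  then show ?case
    using Cauchy_integral_formula_global[OF U(1) 0 U(2) \<gamma>(1,3,2) w(2)] w(1) by simp
next
  case (Suc j)
  let ?g = "divided_diff c f"
  have "?g holomorphic_on U"
    unfolding divided_diff_def using Suc.prems U(1) by (rule pole_lemma_open)
  from Suc.IH[OF this] have g: "((\<lambda>z. ?g z / (z - c) ^ Suc j) has_contour_integral
      2 * of_real pi * \<i> * (divided_diff c ^^ Suc j) f c) \<gamma>"
    by (simp only: funpow_Suc_right o_def)
  have "((\<lambda>z. f c / (z - c) ^ Suc (Suc j)) has_contour_integral 0) \<gamma>"
  proof (rule Cauchy_theorem_primitive)
    fix z assume "z \<in> U - {c}"
    then have ne: "z - c \<noteq> 0" by simp
    have "((\<lambda>z. inverse (z - c)) has_field_derivative - inverse ((z - c)\<^sup>2)) (at z within U - {c})"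
      using ne by (auto intro!: derivative_eq_intros simp: power2_eq_square)
    note D = DERIV_cmult[OF DERIV_power_Suc[OF this], of "- f c / of_nat (Suc j)" j]
    have "1 + of_nat j = (of_nat (Suc j) :: complex)" "of_nat (Suc j) \<noteq> (0::complex)"
      by (simp, simp only: of_nat_eq_0_iff nat.simps simp_thms)
    then have "- f c / of_nat (Suc j) * ((1 + of_nat j) * (- inverse ((z - c)\<^sup>2) * inverse (z - c) ^ j))
        = f c / (z - c) ^ Suc (Suc j)"
      using ne by (simp add: divide_simps power2_eq_square del: of_nat_Suc)
    from DERIV_cong[OF D this]
    show "((\<lambda>z. - f c / of_nat (Suc j) * inverse (z - c) ^ Suc j) has_field_derivative
        f c / (z - c) ^ Suc (Suc j)) (at z within U - {c})" .
  qed (use \<gamma> in auto)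
  from has_contour_integral_add[OF this g]
  have "((\<lambda>z. f z / (z - c) ^ Suc (Suc j)) has_contour_integral
      0 + 2 * of_real pi * \<i> * (divided_diff c ^^ Suc j) f c) \<gamma>"
  proof (rule has_contour_integral_eq)
    fix z assume "z \<in> path_image \<gamma>"
    then have "z - c \<noteq> 0" using \<gamma>(3) by auto
    then show "f c / (z - c) ^ Suc (Suc j) + ?g z / (z - c) ^ Suc j = f z / (z - c) ^ Suc (Suc j)"
      by (simp add: divided_diff_def flip: add_divide_distrib)
  qed
  then show ?case by (simp only: add_0)
qed

section \<open>Spectrum and resolvent of the backward difference\<close>

text \<open>Here \<open>z - \<Delta> = (z - 1/h) + F/h\<close>, and these are the power series coefficients of its
  reciprocal when \<open>F\<close> is read as an indeterminate.\<close>

definition resolvent_kernel :: "real \<Rightarrow> complex \<Rightarrow> nat \<Rightarrow> complex" where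
  "resolvent_kernel h z j = (- 1 / of_real h) ^ j / (z - of_real (1 / h)) ^ Suc j"

text \<open>On the space of all sequences, read as formal power series, \<open>F\<close> is multiplication by the
  indeterminate and convolution is the product. So \<open>z - \<Delta>\<close> is multiplication by a linear
  polynomial, invertible as soon as its constant term \<open>z - 1/h\<close> is nonzero. Whether the inverse
  preserves \<open>X\<close> is a separate question.\<close>

lemma shifted_backward_diff_iff:
  assumes z: "z \<noteq> of_real (1 / h)"
  shows "shifted_op (backward_diff h) z y = x \<longleftrightarrow> y = convolution (resolvent_kernel h z) x"
proof -
  define P where "P = fps_const (z - of_real (1/h)) + fps_const (of_real (1/h)) * fps_X"
  let ?K = "Abs_fps (resolvent_kernel h z)"
  have P: "Abs_fps (shifted_op (backward_diff h) z y) = P * Abs_fps y"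
  proof (rule fps_ext)
    fix k show "fps_nth (Abs_fps (shifted_op (backward_diff h) z y)) k = fps_nth (P * Abs_fps y) k"
      by (cases k) (simp_all add: P_def distrib_right mult.assoc shifted_op_def backward_diff_def
          forward_shift_def algebra_simps diff_divide_distrib)
  qed
  have K: "Abs_fps (convolution (resolvent_kernel h z) x) = ?K * Abs_fps x"
    by (rule fps_ext) (simp add: convolution_def fps_mult_nth atLeast0AtMost)
  have PK: "P * ?K = 1"
  proof (rule fps_ext)
    fix k
    have "z - of_real (1/h) \<noteq> 0" using z by simp
    then show "fps_nth (P * ?K) k = fps_nth 1 k"
      by (cases k) (simp_all add: P_def distrib_right mult.assoc resolvent_kernel_def)
  qed
  have "shifted_op (backward_diff h) z y = x \<longleftrightarrow> P * Abs_fps y = Abs_fps x"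
    unfolding P[symmetric] by (simp add: fps_eq_iff fun_eq_iff)
  also have "\<dots> \<longleftrightarrow> Abs_fps y = ?K * Abs_fps x"
  proof
    assume "P * Abs_fps y = Abs_fps x"
    then have "?K * Abs_fps x = ?K * (P * Abs_fps y)" by simp
    also have "\<dots> = (P * ?K) * Abs_fps y" by (simp only: mult_ac)
    finally have "?K * Abs_fps x = (P * ?K) * Abs_fps y" .
    then show "Abs_fps y = ?K * Abs_fps x" by (simp add: PK)
  next
    assume "Abs_fps y = ?K * Abs_fps x"
    then show "P * Abs_fps y = Abs_fps x" using PK by (simp flip: mult.assoc)
  qed
  also have "\<dots> \<longleftrightarrow> y = convolution (resolvent_kernel h z) x"
    unfolding K[symmetric] by (simp add: fps_eq_iff fun_eq_iff)
  finally show ?thesis .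
qed

lemma norm_resolvent_kernel:
  assumes "h > 0"
  shows "norm (resolvent_kernel h z j) = (1 / (h * norm (z - of_real (1/h)))) ^ j / norm (z - of_real (1/h))"
  using assms by (simp add: resolvent_kernel_def norm_divide norm_power norm_mult power_divide power_mult_distrib)

lemma convolution_add: "convolution b (\<lambda>k. x k + y k) = (\<lambda>k. convolution b x k + convolution b y k)"
  by (simp add: convolution_def distrib_left sum.distrib)

lemma convolution_scale: "convolution b (\<lambda>k. c * x k) = (\<lambda>k. c * convolution b x k)"
  by (simp add: convolution_def sum_distrib_left mult_ac)

context sequence_space
begin

text \<open>At \<open>z = 1/h\<close> the operator \<open>z - \<Delta> = F/h\<close> misses the first unit vector. Hence every
  admissible contour winds around this point once, as Cauchy's formula requires.\<close>

lemma center_in_spectrum: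
  "of_real (1 / h) \<in> spectrum_on X N (backward_diff h)"
proof (rule ccontr)
  assume "\<not> ?thesis"
  then obtain R :: "cseq \<Rightarrow> cseq" where R: "\<forall>x\<in>X. R (shifted_op (backward_diff h) (of_real (1/h)) x) = x \<and>
      shifted_op (backward_diff h) (of_real (1/h)) (R x) = x"
    unfolding spectrum_on_def by blast
  from bspec[OF R unit_mem]
  have "shifted_op (backward_diff h) (of_real (1/h)) (R (\<lambda>k. if k = 0 then 1 else 0)) 0 = 1"
    by simp
  then show False by (simp add: shifted_op_def backward_diff_def forward_shift_def)
qed

text \<open>Outside the closed disc the kernel is a geometric sequence of ratio less than 1 in modulus.\<close>

lemma spectrum_subset_cball:
  assumes h: "h > 0"
  shows "spectrum_on X N (backward_diff h) \<subseteq> cball (of_real (1 / h)) (1 / h)"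
proof (rule subsetI, rule ccontr)
  fix z assume z: "z \<in> spectrum_on X N (backward_diff h)" "z \<notin> cball (of_real (1 / h)) (1 / h)"
  let ?R = "convolution (resolvent_kernel h z)"
  have r: "1 / h < norm (z - of_real (1/h))" using z(2) by (simp add: dist_norm norm_minus_commute)
  then have ne: "z \<noteq> of_real (1/h)" using h by auto
  have "1 / (h * norm (z - of_real (1/h))) < 1" using r h by (simp add: field_simps)
  then have s: "summable (\<lambda>j. norm (resolvent_kernel h z j))"
    unfolding norm_resolvent_kernel[OF h] using h by (intro summable_divide summable_geometric) auto
  have "bounded_op X N ?R"
    unfolding bounded_op_def
  proof (intro conjI ballI allI)
    show "\<exists>M. \<forall>x\<in>X. N (?R x) \<le> M * N x" using convolution_mem_norm(2)[OF s] by blast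
  qed (simp_all only: convolution_mem_norm(1)[OF s] convolution_add convolution_scale)
  moreover have "?R (shifted_op (backward_diff h) z x) = x \<and> shifted_op (backward_diff h) z (?R x) = x" for x
    using shifted_backward_diff_iff[OF ne, of x "shifted_op (backward_diff h) z x"]
      shifted_backward_diff_iff[OF ne, of "?R x" x] by simp
  ultimately show False using z(1) unfolding spectrum_on_def by blast
qed

text \<open>Surjectivity of \<open>z - \<Delta>\<close> on \<open>X\<close> comes from the definition of the spectrum, and injectivity
  holds on all sequences. The argument is algebraic, so it applies along contours of arbitrary
  shape.\<close>

lemma resolvent_eq_convolution:
  assumes z: "z \<notin> spectrum_on X N (backward_diff h)" and x: "x \<in> X"
  shows "resolvent_on X (backward_diff h) z x = convolution (resolvent_kernel h z) x"
    "convolution (resolvent_kernel h z) x \<in> X"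
proof -
  have ne: "z \<noteq> of_real (1/h)" using z center_in_spectrum by blast
  obtain R where R: "bounded_op X N R" "shifted_op (backward_diff h) z (R x) = x"
    using z x unfolding spectrum_on_def by blast
  then have "R x \<in> X" using x by (simp add: bounded_op_def)
  then have *: "x \<in> shifted_op (backward_diff h) z ` X" using R(2) by force
  show "resolvent_on X (backward_diff h) z x = convolution (resolvent_kernel h z) x"
    using f_inv_into_f[OF *] unfolding resolvent_on_def shifted_backward_diff_iff[OF ne] .
  with inv_into_into[OF *] show "convolution (resolvent_kernel h z) x \<in> X"
    by (simp add: resolvent_on_def)
qed

text \<open>Norm convergence of the Riemann sums implies entrywise convergence, so the entries of a
  vector-valued integral are ordinary contour integrals.\<close>

lemma has_seq_contour_integral_coord:
  assumes F: "\<And>z. z \<in> path_image \<gamma> \<Longrightarrow> F z \<in> X" and y: "has_seq_contour_integral X N F y \<gamma>"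
  shows "((\<lambda>z. F z k) has_contour_integral y k) \<gamma>"
proof -
  define g where "g t k = F (\<gamma> t) k * vector_derivative \<gamma> (at t within {0..1})" for t k
  define S where "S D k = (\<Sum>(t, K)\<in>D. complex_of_real (measure lborel K) * g t k)" for D :: "(real \<times> real set) set" and k
  have yX: "y \<in> X" and lim: "((\<lambda>D. N (\<lambda>k. S D k - y k)) \<longlongrightarrow> 0) (division_filter {0..1})"
    using y by (simp_all only: has_seq_contour_integral_def has_seq_integral_def S_def g_def)
  have "\<forall>\<^sub>F D in division_filter {0..1}. D tagged_division_of {0..1::real}"
    by (rule eventually_division_filter_tagged_division)
  then have ev: "\<forall>\<^sub>F D in division_filter {0..1}. norm (S D k - y k) \<le> N (\<lambda>k. S D k - y k)"
  proof eventually_elim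
    case (elim D)
    have "g t \<in> X" if "(t, K) \<in> D" for t K
    proof -
      have "t \<in> {0..1}" using elim that by (blast dest: tag_in_interval)
      then have "F (\<gamma> t) \<in> X" by (intro F) (auto simp: path_image_def)
      moreover have "g t = (\<lambda>k. vector_derivative \<gamma> (at t within {0..1}) * F (\<gamma> t) k)"
        by (simp add: g_def fun_eq_iff)
      ultimately show ?thesis using scale_mem by simp
    qed
    then have "(\<lambda>k. \<Sum>p\<in>D. complex_of_real (measure lborel (snd p)) * g (fst p) k) \<in> X"
      by (intro sum_mem scale_mem) auto
    moreover have "S D = (\<lambda>k. \<Sum>p\<in>D. complex_of_real (measure lborel (snd p)) * g (fst p) k)"
      by (simp add: S_def split_def fun_eq_iff)
    ultimately have "S D \<in> X" by simp
    then show ?case using coord_le[OF diff_mem[OF _ yX], of "S D" k] by simp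
  qed
  have "((\<lambda>D. S D k - y k) \<longlongrightarrow> 0) (division_filter {0..1})"
    by (rule Lim_null_comparison[OF ev lim])
  then have "((\<lambda>D. S D k) \<longlongrightarrow> y k) (division_filter {0..1})"
    by (simp add: LIM_zero_iff)
  then have "((\<lambda>t. g t k) has_integral y k) {0..1}"
    unfolding S_def using has_integral_cbox[of "\<lambda>t. g t k" "y k" 0 1]
    by (simp add: scaleR_conv_of_real)
  then show ?thesis by (simp add: has_contour_integral_def g_def)
qed

end

section \<open>The functional calculus of the backward difference\<close>

text \<open>The Taylor coefficients at \<open>s = 0\<close> of \<open>f((1 - s) / h)\<close>, as \<open>\<Delta> = (1 - F) / h\<close>.\<close>

definition shift_coeff :: "real \<Rightarrow> (complex \<Rightarrow> complex) \<Rightarrow> nat \<Rightarrow> complex" where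
  "shift_coeff h f j = (- 1 / of_real h) ^ j * (divided_diff (of_real (1 / h)) ^^ j) f (of_real (1 / h))"

lemma contour_integral_kernel:
  assumes U: "open U" "of_real (1 / h) \<in> U" and f: "f holomorphic_on U"
    and \<gamma>: "valid_path \<gamma>" "pathfinish \<gamma> = pathstart \<gamma>" "path_image \<gamma> \<subseteq> U - {of_real (1 / h)}"
    and w: "winding_number \<gamma> (of_real (1 / h)) = 1" "\<And>z. z \<notin> U \<Longrightarrow> winding_number \<gamma> z = 0"
  shows "((\<lambda>z. f z * resolvent_kernel h z j / (2 * of_real pi * \<i>)) has_contour_integral
     shift_coeff h f j) \<gamma>"
  using has_contour_integral_lmul[OF contour_integral_pole[OF assms, where j = j],
      of "(- 1 / of_real h) ^ j / (2 * of_real pi * \<i>)"]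
  by (simp add: resolvent_kernel_def shift_coeff_def mult_ac)

text \<open>The right-hand side contains neither \<open>U\<close> nor \<open>\<gamma>\<close>, which makes the definite description in
  the Riesz--Dunford integral meaningful.\<close>

lemma (in sequence_space) seq_contour_integral_unique:
  assumes U: "open U" "spectrum_on X N (backward_diff h) \<subseteq> U" and f: "f holomorphic_on U"
    and \<gamma>: "surrounds_in \<gamma> (spectrum_on X N (backward_diff h)) U" and x: "x \<in> X"
    and y: "has_seq_contour_integral X N
      (\<lambda>z k. f z * resolvent_on X (backward_diff h) z x k / (2 * of_real pi * \<i>)) y \<gamma>"
  shows "y = convolution (shift_coeff h f) x"
proof
  fix k
  have pa: "z \<notin> spectrum_on X N (backward_diff h)" if "z \<in> path_image \<gamma>" for z
    using \<gamma> that by (auto simp: surrounds_in_def)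
  have "(\<lambda>k. f z * resolvent_on X (backward_diff h) z x k / (2 * of_real pi * \<i>)) \<in> X"
    if "z \<in> path_image \<gamma>" for z
    using scale_mem[OF resolvent_eq_convolution(2)[OF pa[OF that] x], of "f z / (2 * of_real pi * \<i>)"]
    by (simp add: resolvent_eq_convolution(1)[OF pa[OF that] x])
  from has_seq_contour_integral_coord[OF this y]
  have 1: "((\<lambda>z. f z * resolvent_on X (backward_diff h) z x k / (2 * of_real pi * \<i>))
      has_contour_integral y k) \<gamma>" .
  have "((\<lambda>z. \<Sum>j\<le>k. f z * resolvent_kernel h z j / (2 * of_real pi * \<i>) * x (k - j))
      has_contour_integral (\<Sum>j\<le>k. shift_coeff h f j * x (k - j))) \<gamma>"
    using U \<gamma> center_in_spectrum[of h]
    by (intro has_contour_integral_sum has_contour_integral_rmul contour_integral_kernel[OF _ _ f])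
       (auto simp: surrounds_in_def)
  then have "((\<lambda>z. f z * resolvent_on X (backward_diff h) z x k / (2 * of_real pi * \<i>))
      has_contour_integral convolution (shift_coeff h f) x k) \<gamma>"
    unfolding convolution_def
    by (rule has_contour_integral_eq)
       (simp add: resolvent_eq_convolution(1)[OF pa x] convolution_def sum_distrib_left sum_divide_distrib mult_ac)
  with 1 show "y k = convolution (shift_coeff h f) x k"
    by (rule has_contour_integral_unique)
qed

context sequence_space
begin

text \<open>On a circle of radius \<open>r > 1/h\<close> the \<open>j\<close>-th kernel integrand \<open>\<phi> j\<close> is \<open>O(\<rho>\<^sup>j)\<close> with \<open>\<rho> = 1/(h r) < 1\<close>.
  A Riemann sum of the vector-valued integrand is again a convolution, with the scalar Riemann
  sums \<open>S j D\<close> of the \<open>\<phi> j\<close> as coefficients, so by Young's inequality its distance to the limit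
  is at most \<open>(\<Sum>j. |S j D - shift_coeff h f j|) \<cdot> N x\<close>. Each summand tends to 0 and is
  dominated by a geometric sequence, so the sum tends to 0 by Tannery's theorem.\<close>

lemma seq_contour_integral_circle:
  assumes h: "h > 0" and r: "1 / h < r" and f: "f holomorphic_on ball (of_real (1 / h)) R" and R: "r < R"
    and x: "x \<in> X"
  defines "\<gamma> \<equiv> circlepath (of_real (1 / h)) r"
  shows "summable (\<lambda>j. norm (shift_coeff h f j))"
    and "has_seq_contour_integral X N
      (\<lambda>z k. f z * resolvent_on X (backward_diff h) z x k / (2 * of_real pi * \<i>))
      (convolution (shift_coeff h f) x) \<gamma>"
proof -
  let ?c = "complex_of_real (1 / h)"
  let ?F = "division_filter {0..1::real}"
  have r0: "r > 0" using h r by (metis less_trans zero_less_divide_1_iff)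
  define \<rho> where "\<rho> = 1 / (h * r)"
  have \<rho>: "0 \<le> \<rho>" "\<rho> < 1" using h r r0 by (auto simp: \<rho>_def field_simps)
  have pi: "path_image \<gamma> = sphere ?c r" using r0 by (simp add: \<gamma>_def)
  have "continuous_on (sphere ?c r) f"
    using R by (intro holomorphic_on_imp_continuous_on holomorphic_on_subset[OF f]) auto
  then have "compact (f ` sphere ?c r)" by (intro compact_continuous_image) auto
  then have "bounded (f ` sphere ?c r)" by (rule compact_imp_bounded)
  then obtain M where M: "\<And>z. z \<in> sphere ?c r \<Longrightarrow> norm (f z) \<le> M"
    unfolding bounded_iff by (auto simp del: mem_sphere)
  define \<phi> where "\<phi> j t = f (\<gamma> t) * resolvent_kernel h (\<gamma> t) j / (2 * of_real pi * \<i>)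
      * vector_derivative \<gamma> (at t within {0..1})" for j t
  define S where "S j D = (\<Sum>(t, K)\<in>D. complex_of_real (measure lborel K) * \<phi> j t)"
    for j and D :: "(real \<times> real set) set"
  have \<gamma>in: "norm (\<gamma> t - ?c) = r" if "t \<in> {0..1}" for t
  proof -
    have "\<gamma> t \<in> path_image \<gamma>" using that by (auto simp: path_image_def)
    then show ?thesis by (simp add: pi dist_norm norm_minus_commute)
  qed
  have \<phi>_le: "norm (\<phi> j t) \<le> M * \<rho> ^ j" if t: "t \<in> {0..1}" for j t
  proof -
    have "norm (vector_derivative \<gamma> (at t within {0..1})) = 2 * pi * r"
      using t r0 by (simp add: \<gamma>_def vector_derivative_circlepath01 norm_mult)
    then have "norm (\<phi> j t) = norm (f (\<gamma> t)) * norm (resolvent_kernel h (\<gamma> t) j) * r"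
      by (simp add: \<phi>_def norm_mult norm_divide)
    also have "\<dots> = norm (f (\<gamma> t)) * \<rho> ^ j"
      unfolding norm_resolvent_kernel[OF h] \<gamma>in[OF t] using r0 by (simp add: \<rho>_def)
    also have "\<dots> \<le> M * \<rho> ^ j"
      using \<gamma>in[OF t] \<rho> by (intro mult_right_mono M) (auto simp: dist_norm norm_minus_commute)
    finally show ?thesis .
  qed
  have tagged: "\<forall>\<^sub>F D in ?F. D tagged_division_of {0..1}"
    by (rule eventually_division_filter_tagged_division)
  have S_le: "norm (S j D) \<le> M * \<rho> ^ j" if "D tagged_division_of {0..1}" for j D
    using rsum_bound[of D 0 1 "\<phi> j" "M * \<rho> ^ j"] that \<phi>_le
    by (simp add: S_def scaleR_conv_of_real)
  have nt: "?F \<noteq> bot" using division_filter_not_empty[of 0 "1::real"] by simp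
  have lim: "(S j \<longlongrightarrow> shift_coeff h f j) ?F" for j
  proof -
    have "((\<lambda>z. f z * resolvent_kernel h z j / (2 * of_real pi * \<i>)) has_contour_integral
        shift_coeff h f j) \<gamma>"
    proof (rule contour_integral_kernel[OF _ _ f])
      show "path_image \<gamma> \<subseteq> ball ?c R - {?c}" using R r0 by (auto simp: pi)
      show "winding_number \<gamma> ?c = 1" using r0 unfolding \<gamma>_def by (intro winding_number_circlepath) auto
      show "winding_number \<gamma> z = 0" if "z \<notin> ball ?c R" for z
        unfolding \<gamma>_def using that R
        by (intro winding_number_zero_outside[of _ "cball ?c r"]) (use r0 in auto)
    qed (use r0 R in \<open>auto simp: \<gamma>_def\<close>)
    then have "(\<phi> j has_integral shift_coeff h f j) (cbox 0 1)"
      by (simp add: has_contour_integral_def \<phi>_def[abs_def])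
    then show ?thesis unfolding has_integral_cbox by (simp add: S_def[abs_def] scaleR_conv_of_real)
  qed
  have coeff_le: "norm (shift_coeff h f j) \<le> M * \<rho> ^ j" for j
    by (rule Lim_norm_ubound[OF nt lim]) (use tagged S_le in \<open>auto elim: eventually_mono\<close>)
  have geo: "summable (\<lambda>j. M * \<rho> ^ j)" using \<rho> by (intro summable_mult summable_geometric) auto
  show summ: "summable (\<lambda>j. norm (shift_coeff h f j))"
    by (rule summable_comparison_test'[OF geo]) (simp add: coeff_le)
  have diff_le: "norm (S j D - shift_coeff h f j) \<le> 2 * (M * \<rho> ^ j)" if "D tagged_division_of {0..1}" for j D
    using norm_triangle_ineq4[of "S j D" "shift_coeff h f j"] S_le[OF that, of j] coeff_le[of j] by simp
  have geo2: "summable (\<lambda>j. 2 * (M * \<rho> ^ j))" using geo by (rule summable_mult)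
  have "((\<lambda>D. \<Sum>j. norm (S j D - shift_coeff h f j)) \<longlongrightarrow> (\<Sum>j. 0)) ?F"
  proof -
    have "((\<lambda>D. norm (S j D - shift_coeff h f j)) \<longlongrightarrow> 0) ?F" for j
      using lim[of j] by (intro tendsto_norm_zero) (simp add: LIM_zero)
    moreover have "\<forall>\<^sub>F (j, D) in at_top \<times>\<^sub>F ?F. norm (norm (S j D - shift_coeff h f j)) \<le> 2 * (M * \<rho> ^ j)"
      unfolding eventually_prod_filter
      using tagged diff_le by (intro exI[of _ "\<lambda>_. True"] exI[of _ "\<lambda>D. D tagged_division_of {0..1}"]) auto
    ultimately show "((\<lambda>D. \<Sum>j. norm (S j D - shift_coeff h f j)) \<longlongrightarrow> (\<Sum>j. 0)) ?F"
      using tannerys_theorem[OF _ _ geo2 nt, of "\<lambda>j D. norm (S j D - shift_coeff h f j)" "\<lambda>_. 0"]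
      by auto
  qed
  then have lim0: "((\<lambda>D. (\<Sum>j. norm (S j D - shift_coeff h f j)) * N x) \<longlongrightarrow> 0) ?F"
    by (intro tendsto_mult_left_zero) simp
  let ?G = "\<lambda>z k. f z * resolvent_on X (backward_diff h) z x k / (2 * of_real pi * \<i>)"
  have riemann: "(\<Sum>(t, K)\<in>D. complex_of_real (measure lborel K) *
      (?G (\<gamma> t) k * vector_derivative \<gamma> (at t within {0..1}))) - convolution (shift_coeff h f) x k =
      convolution (\<lambda>j. S j D - shift_coeff h f j) x k"
    if D: "D tagged_division_of {0..1}" for D k
  proof -
    have "complex_of_real (measure lborel K) * (?G (\<gamma> t) k * vector_derivative \<gamma> (at t within {0..1}))
        = (\<Sum>j\<le>k. complex_of_real (measure lborel K) * \<phi> j t * x (k - j))" if "(t, K) \<in> D" for t K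
    proof -
      have "t \<in> {0..1}" using D that by (blast dest: tag_in_interval)
      then have "\<gamma> t \<notin> cball ?c (1/h)" using \<gamma>in[of t] r by (simp add: dist_norm norm_minus_commute)
      then have "\<gamma> t \<notin> spectrum_on X N (backward_diff h)" using spectrum_subset_cball[OF h] by blast
      from resolvent_eq_convolution(1)[OF this x] show ?thesis
        by (simp add: convolution_def \<phi>_def sum_distrib_left sum_distrib_right sum_divide_distrib mult_ac)
    qed
    then have "(\<Sum>(t, K)\<in>D. complex_of_real (measure lborel K) *
        (?G (\<gamma> t) k * vector_derivative \<gamma> (at t within {0..1}))) =
        (\<Sum>(t, K)\<in>D. \<Sum>j\<le>k. complex_of_real (measure lborel K) * \<phi> j t * x (k - j))"
      by (intro sum.cong) auto
    also have "\<dots> = (\<Sum>j\<le>k. S j D * x (k - j))"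
      unfolding S_def split_def sum_distrib_right by (rule sum.swap)
    finally show ?thesis
      by (simp add: convolution_def sum_subtractf left_diff_distrib)
  qed
  show "has_seq_contour_integral X N ?G (convolution (shift_coeff h f) x) \<gamma>"
    unfolding has_seq_contour_integral_def has_seq_integral_def
  proof (intro conjI convolution_mem_norm(1)[OF summ x] tendsto_sandwich[OF _ _ tendsto_const lim0])
    show "\<forall>\<^sub>F D in ?F. 0 \<le> N (\<lambda>k. (\<Sum>(t, K)\<in>D. complex_of_real (measure lborel K) *
      (?G (\<gamma> t) k * vector_derivative \<gamma> (at t within {0..1}))) - convolution (shift_coeff h f) x k)"
      using tagged
    proof eventually_elim
      case (elim D)
      have "summable (\<lambda>j. norm (S j D - shift_coeff h f j))"
        by (rule summable_comparison_test'[OF geo2]) (simp add: diff_le[OF elim])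
      then show ?case
        unfolding riemann[OF elim] by (intro norm_nonneg convolution_mem_norm(1)[OF _ x])
    qed
    show "\<forall>\<^sub>F D in ?F. N (\<lambda>k. (\<Sum>(t, K)\<in>D. complex_of_real (measure lborel K) *
      (?G (\<gamma> t) k * vector_derivative \<gamma> (at t within {0..1}))) - convolution (shift_coeff h f) x k)
      \<le> (\<Sum>j. norm (S j D - shift_coeff h f j)) * N x"
      using tagged
    proof eventually_elim
      case (elim D)
      have "summable (\<lambda>j. norm (S j D - shift_coeff h f j))"
        by (rule summable_comparison_test'[OF geo2]) (simp add: diff_le[OF elim])
      then show ?case
        unfolding riemann[OF elim] by (rule convolution_mem_norm(2)[OF _ x])
    qed
  qed
qed

text \<open>The circle through the middle of the annulus \<open>1/h < |z - 1/h| < R\<close> is an admissible contour.\<close>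

theorem riesz_dunford_backward_diff:
  assumes h: "h > 0" and R: "1 / h < R" and f: "f holomorphic_on ball (of_real (1 / h)) R"
    and x: "x \<in> X"
  shows "summable (\<lambda>j. norm (shift_coeff h f j))"
    and "riesz_dunford X N f (backward_diff h) x = convolution (shift_coeff h f) x"
proof -
  define r where "r = (1 / h + R) / 2"
  have r: "1 / h < r" "r < R" using R by (auto simp: r_def)
  have r0: "r > 0" using h r by (metis less_trans zero_less_divide_1_iff)
  let ?c = "complex_of_real (1 / h)"
  let ?\<gamma> = "circlepath ?c r"
  note I = seq_contour_integral_circle[OF h r(1) f r(2) x]
  show "summable (\<lambda>j. norm (shift_coeff h f j))" by (rule I(1))
  have sub: "spectrum_on X N (backward_diff h) \<subseteq> ball ?c r"
    using spectrum_subset_cball[OF h] r by (force simp: subset_iff)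
  have surr: "surrounds_in ?\<gamma> (spectrum_on X N (backward_diff h)) (ball ?c R)"
    unfolding surrounds_in_def
  proof (intro conjI ballI allI impI)
    show "path_image ?\<gamma> \<subseteq> ball ?c R - spectrum_on X N (backward_diff h)"
      using sub r r0 by auto
    show "winding_number ?\<gamma> z = 1" if "z \<in> spectrum_on X N (backward_diff h)" for z
      using sub that by (intro winding_number_circlepath) (auto simp: dist_norm norm_minus_commute)
    show "winding_number ?\<gamma> z = 0" if "z \<notin> ball ?c R" for z
      using that r by (intro winding_number_zero_outside[of _ "cball ?c r"]) (use r0 in auto)
  qed auto
  show "riesz_dunford X N f (backward_diff h) x = convolution (shift_coeff h f) x"
    unfolding riesz_dunford_def
  proof (rule the_equality)
    show "\<exists>U \<gamma>. open U \<and> spectrum_on X N (backward_diff h) \<subseteq> U \<and> f holomorphic_on U \<and>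
        surrounds_in \<gamma> (spectrum_on X N (backward_diff h)) U \<and>
        has_seq_contour_integral X N
          (\<lambda>z k. f z * resolvent_on X (backward_diff h) z x k / (2 * of_real pi * \<i>))
          (convolution (shift_coeff h f) x) \<gamma>"
      using sub r by (intro exI[of _ "ball ?c R"] exI[of _ ?\<gamma>] conjI f surr I(2)) auto
  qed (use seq_contour_integral_unique x in blast)
qed

end

section \<open>The companion matrix and its scalar dynamics\<close>

text \<open>The recursion expresses that \<open>w\<close>, normalized by \<open>w n = 1\<close>, is a left eigenvector for the
  eigenvalue \<open>l\<close> of the companion matrix with last row \<open>c 1, \<dots>, c n\<close>; the condition \<open>w 0 = 0\<close> is
  the equation of the first column. Run downwards from \<open>n\<close>, the recursion makes \<open>w (n - k)\<close> a
  monic polynomial in \<open>l\<close> of degree \<open>k\<close> (Horner's scheme), and \<open>w 0\<close> is the characteristic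
  polynomial, which has a root.\<close>

lemma companion_left_eigenvector:
  fixes c :: "nat \<Rightarrow> complex"
  assumes n: "n \<ge> 1"
  obtains l and w :: "nat \<Rightarrow> complex" where "w n = 1" "w 0 = 0" "\<And>i. i < n \<Longrightarrow> w i = l * w (Suc i) - c (Suc i)"
proof -
  define W :: "nat \<Rightarrow> complex poly" where "W = rec_nat 1 (\<lambda>k p. pCons (- c (n - k)) p)"
  have W: "W 0 = 1" "W (Suc k) = pCons (- c (n - k)) (W k)" for k by (simp_all add: W_def)
  have deg: "degree (W k) = k \<and> W k \<noteq> 0" for k
    by (induction k) (auto simp: W)
  have "\<not> constant (poly (W n))" using n deg[of n] by (simp add: constant_degree)
  then obtain l where l: "poly (W n) l = 0" using fundamental_theorem_of_algebra by blast
  show thesis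
  proof (rule that[of "\<lambda>i. poly (W (n - i)) l" l])
    fix i assume "i < n"
    then have "n - i = Suc (n - Suc i)" "n - (n - Suc i) = Suc i" by auto
    then show "poly (W (n - i)) l = l * poly (W (n - Suc i)) l - c (Suc i)" by (simp add: W)
  qed (use l in \<open>simp_all add: W\<close>)
qed

text \<open>This is \<open>w M = l w\<close> applied to the vector \<open>u\<close>, where the conditional expression is the \<open>i\<close>-th
  entry of \<open>M u\<close>. With \<open>w 0 = 0\<close> the shifted sum may start at index 0.\<close>

lemma companion_functional_step:
  fixes w c u :: "nat \<Rightarrow> complex"
  assumes n: "n \<ge> 1" and w: "w n = 1" "w 0 = 0" "\<And>i. i < n \<Longrightarrow> w i = l * w (Suc i) - c (Suc i)"
  shows "(\<Sum>i=1..n. w i * (if i < n then u (i + 1) else \<Sum>j=1..n. c j * u j)) = l * (\<Sum>i=1..n. w i * u i)"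
proof -
  obtain m where m: "n = Suc m" using n by (cases n) auto
  have "(\<Sum>i=1..n. w i * (if i < n then u (i + 1) else \<Sum>j=1..n. c j * u j))
      = (\<Sum>i=1..m. w i * u (Suc i)) + (\<Sum>j=1..n. c j * u j)"
    using w(1) by (simp add: m)
  also have "(\<Sum>i=1..m. w i * u (Suc i)) = (\<Sum>i=0..m. w i * u (Suc i))"
    using w(2) by (simp add: sum.atLeast_Suc_atMost[of 0 m])
  also have "\<dots> = (\<Sum>j=1..n. w (j - 1) * u j)"
    unfolding m One_nat_def sum.shift_bounds_cl_Suc_ivl by simp
  also have "\<dots> + (\<Sum>j=1..n. c j * u j) = (\<Sum>j=1..n. l * (w j * u j))"
    unfolding sum.distrib[symmetric]
  proof (rule sum.cong)
    fix j assume "j \<in> {1..n}"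
    then have "j - 1 < n" "Suc (j - 1) = j" by auto
    then have "w (j - 1) = l * w j - c j" using w(3)[of "j - 1"] by simp
    then show "w (j - 1) * u j + c j * u j = l * (w j * u j)"
      by (simp only:) (simp add: algebra_simps)
  qed simp
  finally show ?thesis by (simp add: sum_distrib_left)
qed

text \<open>The modulus \<open>e\<^bsup>t Re l\<^esup> |b|\<close> is monotone in \<open>t\<close>: either the orbit is bounded or it avoids a
  neighbourhood of 0.\<close>

lemma exp_orbit_not_dense:
  fixes l b :: complex
  shows "closure {exp (of_real t * l) * b | t::real. 0 \<le> t} \<noteq> UNIV"
proof
  assume dense: "closure {exp (of_real t * l) * b | t::real. 0 \<le> t} = UNIV"
  have norm: "norm (exp (of_real t * l) * b) = exp (t * Re l) * norm b" for t by (simp add: norm_mult)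
  show False
  proof (cases "Re l \<le> 0 \<or> b = 0")
    case True
    have "{exp (of_real t * l) * b | t::real. 0 \<le> t} \<subseteq> cball 0 (norm b)"
    proof clarsimp
      fix t :: real assume "0 \<le> t"
      then have "t * Re l \<le> 0 \<or> b = 0" using True by (auto intro: mult_nonneg_nonpos)
      then show "norm (exp (of_real t * l) * b) \<le> norm b"
        unfolding norm using mult_right_mono[of "exp (t * Re l)" 1 "norm b"] by auto
    qed
    then have "closure {exp (of_real t * l) * b | t::real. 0 \<le> t} \<subseteq> cball 0 (norm b)"
      by (rule closure_minimal) simp
    then have "of_real (norm b + 1) \<in> cball (0::complex) (norm b)" unfolding dense by blast
    then show False by (simp add: norm_of_real del: of_real_add)
  next
    case False
    have "{exp (of_real t * l) * b | t::real. 0 \<le> t} \<subseteq> - ball 0 (norm b)"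
    proof clarsimp
      fix t :: real assume "0 \<le> t" "norm (exp (of_real t * l) * b) < norm b"
      moreover from this(1) have "t * Re l \<ge> 0" using False by auto
      ultimately show False
        unfolding norm using mult_right_mono[of 1 "exp (t * Re l)" "norm b"] by auto
    qed
    then have "closure {exp (of_real t * l) * b | t::real. 0 \<le> t} \<subseteq> - ball 0 (norm b)"
      by (rule closure_minimal) (simp add: closed_Compl)
    then have "0 \<in> - ball (0::complex) (norm b)" unfolding dense by blast
    then show False using False by simp
  qed
qed

section \<open>Exponentials of bounded operators on powers of the space\<close>

context sequence_space
begin

text \<open>Boundedness of \<open>A\<close> is expressed with the maximum norm on \<open>X\<^sup>n\<close>. The definite description in
  \<open>exp_semigroup\<close> denotes the limit because the series converges absolutely in each component
  and the product topology is Hausdorff.\<close>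

lemma exp_semigroup_limit:
  assumes A: "\<And>u. u \<in> {1..n} \<rightarrow>\<^sub>E X \<Longrightarrow> A u \<in> {1..n} \<rightarrow>\<^sub>E X"
    and bound: "\<And>u M. u \<in> {1..n} \<rightarrow>\<^sub>E X \<Longrightarrow> (\<And>i. i \<in> {1..n} \<Longrightarrow> N (u i) \<le> M) \<Longrightarrow>
      (\<And>i. i \<in> {1..n} \<Longrightarrow> N (A u i) \<le> C * M)"
    and u: "u \<in> {1..n} \<rightarrow>\<^sub>E X"
  shows "limitin (power_topology n X N)
        (\<lambda>K. \<lambda>i\<in>{1..n}. \<lambda>k. \<Sum>l<K. of_real (t ^ l / fact l) * (A ^^ l) u i k)
        (exp_semigroup n X N A t u) sequentially"
proof -
  define M where "M = (\<Sum>i\<in>{1..n}. N (u i))"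
  have uX: "u i \<in> X" if "i \<in> {1..n}" for i using u that by auto
  have mem: "(A ^^ l) u \<in> {1..n} \<rightarrow>\<^sub>E X" for l by (induction l) (simp_all add: A u del: One_nat_def)
  have le: "\<forall>i\<in>{1..n}. N ((A ^^ l) u i) \<le> C ^ l * M" for l
  proof (induction l)
    case 0
    then show ?case unfolding M_def by (auto intro!: member_le_sum norm_nonneg uX)
  next
    case (Suc l)
    then show ?case using bound[OF mem[of l], of "C ^ l * M"] by (simp add: mult.assoc)
  qed
  define v where "v i l = (\<lambda>k. of_real (t ^ l / fact l) * (A ^^ l) u i k)" for i l
  define b where "b l = \<bar>t\<bar> ^ l / fact l * (C ^ l * M)" for l
  have v: "v i l \<in> X" if "i \<in> {1..n}" for i l unfolding v_def using mem[of l] that by (intro scale_mem) auto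
  have v_le: "N (v i l) \<le> b l" if "i \<in> {1..n}" for i l
  proof -
    have "(A ^^ l) u i \<in> X" using mem[of l] that by auto
    from norm_scale[OF this, of "of_real (t ^ l / fact l)"] have "N (v i l) = \<bar>t\<bar> ^ l / fact l * N ((A ^^ l) u i)"
      unfolding v_def norm_of_real by (simp add: power_abs)
    also have "\<dots> \<le> b l" unfolding b_def using le that by (intro mult_left_mono) auto
    finally show ?thesis .
  qed
  have "summable (\<lambda>l. inverse (fact l) * (\<bar>t\<bar> * C) ^ l * M)"
    by (intro summable_mult2 summable_exp)
  then have b: "summable b" by (rule summable_cong[THEN iffD1, rotated]) (simp add: b_def power_mult_distrib field_simps)
  have "\<exists>y. y \<in> X \<and> (\<forall>K. N (\<lambda>k. y k - (\<Sum>l<K. v i l k)) \<le> (\<Sum>l. b (l + K)))" if "i \<in> {1..n}" for i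
    by (rule absolutely_convergent_series[OF v[OF that] v_le[OF that] b]) blast
  then obtain y where y: "\<And>i. i \<in> {1..n} \<Longrightarrow> y i \<in> X"
    "\<And>i K. i \<in> {1..n} \<Longrightarrow> N (\<lambda>k. y i k - (\<Sum>l<K. v i l k)) \<le> (\<Sum>l. b (l + K))"
    by metis
  have sum: "(\<lambda>k. \<Sum>l<K. v i l k) \<in> X" if "i \<in> {1..n}" for i K using v[OF that] by (rule sum_mem)
  have "limitin (power_topology n X N) (\<lambda>K. \<lambda>i\<in>{1..n}. \<lambda>k. \<Sum>l<K. v i l k) (restrict y {1..n}) sequentially"
    unfolding power_topology_def limitin_componentwise
  proof (intro conjI ballI)
    show "\<forall>\<^sub>F K in sequentially. (\<lambda>i\<in>{1..n}. \<lambda>k. \<Sum>l<K. v i l k) \<in> topspace (product_topology (\<lambda>_. seq_topology X N) {1..n})"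
      unfolding topspace_power[unfolded power_topology_def] restrict_PiE_iff
      by (intro always_eventually allI ballI sum)
    fix i assume i: "i \<in> {1..n}"
    have "limitin (seq_topology X N) (\<lambda>K k. \<Sum>l<K. v i l k) (y i) sequentially"
    proof (rule limitin_seq_topologyI[OF y(1)[OF i] sum[OF i]])
      show "(\<lambda>K. N (\<lambda>k. y i k - (\<Sum>l<K. v i l k))) \<longlonglongrightarrow> 0"
        by (rule tendsto_sandwich[OF _ _ tendsto_const suminf_exist_split2[OF b]])
           (use i in \<open>auto intro!: always_eventually y norm_nonneg diff_mem sum\<close>)
    qed
    then show "limitin (seq_topology X N) (\<lambda>K. (\<lambda>i\<in>{1..n}. \<lambda>k. \<Sum>l<K. v i l k) i) (restrict y {1..n} i) sequentially"
      using i by simp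
  qed auto
  then have "\<exists>!z. limitin (power_topology n X N) (\<lambda>K. \<lambda>i\<in>{1..n}. \<lambda>k. \<Sum>l<K. v i l k) z sequentially"
    using limitin_Hausdorff_unique[OF _ _ _ Hausdorff_power] trivial_limit_sequentially by blast
  then show ?thesis unfolding exp_semigroup_def v_def by (rule theI')
qed

text \<open>An eigenfunctional of the generator built from continuous entries is an eigenfunctional of
  the semigroup: it may be applied to the exponential series term by term.\<close>

lemma exp_semigroup_eigenfunctional:
  assumes A: "\<And>u. u \<in> {1..n} \<rightarrow>\<^sub>E X \<Longrightarrow> A u \<in> {1..n} \<rightarrow>\<^sub>E X"
    and bound: "\<And>u M. u \<in> {1..n} \<rightarrow>\<^sub>E X \<Longrightarrow> (\<And>i. i \<in> {1..n} \<Longrightarrow> N (u i) \<le> M) \<Longrightarrow>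
      (\<And>i. i \<in> {1..n} \<Longrightarrow> N (A u i) \<le> C * M)"
    and eig: "\<And>u. u \<in> {1..n} \<rightarrow>\<^sub>E X \<Longrightarrow> (\<Sum>i=1..n. w i * A u i 0) = l * (\<Sum>i=1..n. w i * u i 0)"
    and u: "u \<in> {1..n} \<rightarrow>\<^sub>E X"
  shows "(\<Sum>i=1..n. w i * exp_semigroup n X N A t u i 0) = exp (of_real t * l) * (\<Sum>i=1..n. w i * u i 0)"
proof -
  let ?T = "\<lambda>K. \<lambda>i\<in>{1..n}. \<lambda>k. \<Sum>r<K. of_real (t ^ r / fact r) * (A ^^ r) u i k"
  have mem: "(A ^^ r) u \<in> {1..n} \<rightarrow>\<^sub>E X" for r by (induction r) (simp_all add: A u del: One_nat_def)
  have pow: "(\<Sum>i=1..n. w i * (A ^^ r) u i 0) = l ^ r * (\<Sum>i=1..n. w i * u i 0)" for r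
    by (induction r) (simp_all add: eig[OF mem] mult.assoc del: One_nat_def)
  have "(\<lambda>K. \<Sum>i=1..n. w i * ?T K i 0) \<longlonglongrightarrow> (\<Sum>i=1..n. w i * exp_semigroup n X N A t u i 0)"
  proof (intro tendsto_sum tendsto_mult_left)
    fix i assume i: "i \<in> {1..n}"
    have "limitin (seq_topology X N) (\<lambda>K. ?T K i) (exp_semigroup n X N A t u i) sequentially"
      using exp_semigroup_limit[of n A C, OF A bound u, of t] i
      unfolding power_topology_def limitin_componentwise by blast
    from continuous_map_limit[OF continuous_coord[of 0] this]
    show "(\<lambda>K. ?T K i 0) \<longlonglongrightarrow> exp_semigroup n X N A t u i 0" by (simp add: o_def)
  qed
  moreover have "(\<Sum>i=1..n. w i * ?T K i 0) = (\<Sum>r<K. ((of_real t * l) ^ r /\<^sub>R fact r)) * (\<Sum>i=1..n. w i * u i 0)" for K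
  proof -
    have "(\<Sum>i=1..n. w i * ?T K i 0) = (\<Sum>i=1..n. \<Sum>r<K. of_real (t ^ r / fact r) * (w i * (A ^^ r) u i 0))"
      by (intro sum.cong) (simp_all add: sum_distrib_left mult_ac)
    also have "\<dots> = (\<Sum>r<K. of_real (t ^ r / fact r) * (\<Sum>i=1..n. w i * (A ^^ r) u i 0))"
      by (subst sum.swap) (simp add: sum_distrib_left)
    also have "\<dots> = (\<Sum>r<K. ((of_real t * l) ^ r /\<^sub>R fact r) * (\<Sum>i=1..n. w i * u i 0))"
      unfolding pow by (intro sum.cong) (simp_all add: scaleR_conv_of_real power_mult_distrib divide_inverse mult_ac)
    finally show ?thesis by (simp add: sum_distrib_right)
  qed
  moreover have "(\<lambda>K. (\<Sum>r<K. ((of_real t * l) ^ r /\<^sub>R fact r)) * (\<Sum>i=1..n. w i * u i 0))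
      \<longlonglongrightarrow> exp (of_real t * l) * (\<Sum>i=1..n. w i * u i 0)"
    by (intro tendsto_mult_right) (use exp_converges[of "of_real t * l"] in \<open>simp add: sums_def\<close>)
  ultimately show ?thesis using LIMSEQ_unique by simp
qed

text \<open>A continuous surjection maps a dense orbit to a dense set, here to an orbit of the scalar
  flow \<open>e\<^bsup>t l\<^esup>\<close>. Surjectivity holds because one coefficient of the functional is nonzero.\<close>

lemma no_dense_orbit_if_eigenfunctional:
  assumes A: "\<And>u. u \<in> {1..n} \<rightarrow>\<^sub>E X \<Longrightarrow> A u \<in> {1..n} \<rightarrow>\<^sub>E X"
    and bound: "\<And>u M. u \<in> {1..n} \<rightarrow>\<^sub>E X \<Longrightarrow> (\<And>i. i \<in> {1..n} \<Longrightarrow> N (u i) \<le> M) \<Longrightarrow>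
      (\<And>i. i \<in> {1..n} \<Longrightarrow> N (A u i) \<le> C * M)"
    and eig: "\<And>u. u \<in> {1..n} \<rightarrow>\<^sub>E X \<Longrightarrow> (\<Sum>i=1..n. w i * A u i 0) = l * (\<Sum>i=1..n. w i * u i 0)"
    and j: "j \<in> {1..n}" "w j \<noteq> 0"
    and u: "u \<in> {1..n} \<rightarrow>\<^sub>E X"
  shows "power_topology n X N closure_of {exp_semigroup n X N A t u | t. 0 \<le> t} \<noteq> topspace (power_topology n X N)"
proof
  assume dense: "power_topology n X N closure_of {exp_semigroup n X N A t u | t. 0 \<le> t} = topspace (power_topology n X N)"
  define \<phi> where "\<phi> v = (\<Sum>i=1..n. w i * v i 0)" for v :: "nat \<Rightarrow> cseq"
  have "continuous_map (power_topology n X N) euclidean (\<lambda>v. v i 0)" if "i \<in> {1..n}" for i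
    using continuous_map_compose[OF continuous_map_product_projection[OF that, of "\<lambda>_. seq_topology X N"] continuous_coord[of 0]]
    by (simp add: power_topology_def o_def)
  then have cont: "continuous_map (power_topology n X N) euclidean \<phi>"
    unfolding \<phi>_def continuous_map_atin by (auto intro!: tendsto_sum tendsto_mult_left)
  have surj: "z \<in> \<phi> ` topspace (power_topology n X N)" for z
  proof -
    define v :: "nat \<Rightarrow> cseq" where "v = (\<lambda>i\<in>{1..n}. if i = j then (\<lambda>k. z / w j * (if k = 0 then 1 else 0)) else (\<lambda>k. 0))"
    have "v \<in> {1..n} \<rightarrow>\<^sub>E X" using scale_mem[OF unit_mem, of "z / w j"] zero_mem by (auto simp: v_def)
    moreover have "\<phi> v = (\<Sum>i=1..n. if i = j then z else 0)"
      unfolding \<phi>_def using j by (intro sum.cong) (auto simp: v_def)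
    then have "\<phi> v = z" using j by simp
    ultimately show ?thesis unfolding topspace_power by blast
  qed
  have E: "\<phi> (exp_semigroup n X N A t u) = exp (of_real t * l) * \<phi> u" for t
    unfolding \<phi>_def by (rule exp_semigroup_eigenfunctional[of n A C, OF A bound eig u])
  have "UNIV \<subseteq> \<phi> ` topspace (power_topology n X N)" using surj by blast
  also have "\<dots> \<subseteq> closure (\<phi> ` {exp_semigroup n X N A t u | t. 0 \<le> t})"
    using continuous_map_image_closure_subset[OF cont, of "{exp_semigroup n X N A t u | t. 0 \<le> t}"]
    unfolding dense by simp
  also have "\<phi> ` {exp_semigroup n X N A t u | t. 0 \<le> t} = {exp (of_real t * l) * \<phi> u | t::real. 0 \<le> t}"
    unfolding setcompr_eq_image image_image E ..
  finally show False using exp_orbit_not_dense[of l "\<phi> u"] by blast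
qed

end

section \<open>The semidiscretized system has no dense orbit\<close>

text \<open>A polynomial has only finitely many roots, so a closed disc without roots can be enlarged.
  This gives the functions \<open>p\<^sub>i/q\<close> a disc of holomorphy with room for a contour.\<close>

lemma roots_avoid_larger_ball:
  fixes q :: "complex poly"
  assumes "{z. poly q z = 0} \<subseteq> - cball c r"
  obtains R where "r < R" "\<And>z. z \<in> ball c R \<Longrightarrow> poly q z \<noteq> 0"
proof -
  show thesis
  proof (cases "q = 0")
    case True
    then have "c \<in> {z. poly q z = 0}" by simp
    then have "c \<in> - cball c r" using assms by blast
    then have "r < 0" by simp
    then show thesis using that[of 0] by simp
  next
    case False
    define R where "R = Min (insert (r + 1) (dist c ` {z. poly q z = 0}))"
    have fin: "finite (insert (r + 1) (dist c ` {z. poly q z = 0}))" using poly_roots_finite[OF False] by simp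
    have "r < R" unfolding R_def using fin assms by (subst Min_gr_iff) auto
    moreover have "poly q z \<noteq> 0" if "z \<in> ball c R" for z
    proof
      assume "poly q z = 0"
      then have "R \<le> dist c z" unfolding R_def using fin by (intro Min_le) auto
      then show False using that by simp
    qed
    ultimately show thesis by (rule that)
  qed
qed

text \<open>The constants \<open>c j\<close> are the diagonal entries \<open>f\<^sub>j(1/h)\<close> of the lower triangular operators
  \<open>f\<^sub>j(\<Delta>)\<close>; they form the last row of the companion matrix acting on the zeroth entries.\<close>

theorem (in sequence_space) backward_semidiscretization_no_dense_orbit:
  fixes n m :: nat and a :: "nat \<Rightarrow> nat \<Rightarrow> complex" and h :: real
  assumes n: "n \<ge> 1" and h: "h > 0"
    and q: "{z. poly (q_poly n m a) z = 0} \<subseteq> - cball (of_real (1 / h)) (1 / h)"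
    and u: "u \<in> {1..n} \<rightarrow>\<^sub>E X"
  shows "power_topology n X N closure_of {exp_semigroup n X N (A_minus X N n m a h) t u | t. 0 \<le> t}
      \<noteq> topspace (power_topology n X N)"
proof -
  let ?A = "A_minus X N n m a h"
  define f where "f j z = poly (p_poly m a j) z / poly (q_poly n m a) z" for j z
  define b where "b j = shift_coeff h (f j)" for j
  obtain R where R: "1 / h < R" "\<And>z. z \<in> ball (of_real (1 / h)) R \<Longrightarrow> poly (q_poly n m a) z \<noteq> 0"
    using roots_avoid_larger_ball[OF q] by blast
  have "f j holomorphic_on ball (of_real (1 / h)) R" for j
    unfolding f_def[abs_def] using R(2) by (intro holomorphic_intros) auto
  note rd = riesz_dunford_backward_diff[OF h R(1) this, folded b_def]
  have summ: "summable (\<lambda>k. norm (b j k))" for j using rd(1)[OF zero_mem] .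
  define c where "c j = b j 0" for j
  have A: "?A v i = (if i < n then v (i + 1) else (\<lambda>k. \<Sum>j=1..n. convolution (b j) (v j) k))"
    if v: "v \<in> {1..n} \<rightarrow>\<^sub>E X" and "i \<in> {1..n}" for v i
  proof -
    have "riesz_dunford X N (f j) (backward_diff h) (v j) = convolution (b j) (v j)" if "j \<in> {1..n}" for j
      using v that by (intro rd(2)) auto
    then show ?thesis using that(2) by (auto simp: A_minus_def f_def[abs_def] intro!: ext sum.cong)
  qed
  have vX: "v i \<in> X" if "v \<in> {1..n} \<rightarrow>\<^sub>E X" "i \<in> {1..n}" for v i using that by auto
  have conv: "convolution (b j) (v j) \<in> X" if "v \<in> {1..n} \<rightarrow>\<^sub>E X" "j \<in> {1..n}" for v j
    by (rule convolution_mem_norm(1)[OF summ vX[OF that]])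
  have mem: "?A v \<in> {1..n} \<rightarrow>\<^sub>E X" if v: "v \<in> {1..n} \<rightarrow>\<^sub>E X" for v
  proof (rule PiE_I)
    fix i assume i: "i \<in> {1..n}"
    then show "?A v i \<in> X" unfolding A[OF v i] using vX[OF v] conv[OF v] by (auto intro: sum_mem)
  next
    fix i assume "i \<notin> {1..n}"
    then show "?A v i = undefined" unfolding A_minus_def restrict_def by (simp only: if_False)
  qed
  define C where "C = 1 + (\<Sum>j=1..n. \<Sum>k. norm (b j k))"
  have b0: "0 \<le> (\<Sum>k. norm (b j k))" for j by (rule suminf_nonneg[OF summ]) simp
  have bound: "N (?A v i) \<le> C * M"
    if v: "v \<in> {1..n} \<rightarrow>\<^sub>E X" and M: "\<And>i. i \<in> {1..n} \<Longrightarrow> N (v i) \<le> M" and i: "i \<in> {1..n}" for v M i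
  proof -
    have M0: "M \<ge> 0" using norm_nonneg[OF vX[OF v i]] M[OF i] by linarith
    have sb: "0 \<le> (\<Sum>j=1..n. \<Sum>k. norm (b j k))" by (intro sum_nonneg b0)
    show ?thesis
    proof (cases "i < n")
      case True
      then have "N (?A v i) \<le> M" using A[OF v i] M[of "i + 1"] by simp
      also have "\<dots> \<le> C * M" unfolding C_def using M0 sb by (simp add: algebra_simps)
      finally show ?thesis .
    next
      case False
      then have "N (?A v i) \<le> (\<Sum>j=1..n. N (convolution (b j) (v j)))"
        using A[OF v i] norm_sum_le[of "{1..n}" "\<lambda>j. convolution (b j) (v j)"] conv[OF v] by simp
      also have "\<dots> \<le> (\<Sum>j=1..n. (\<Sum>k. norm (b j k)) * M)"
        using convolution_mem_norm(2)[OF summ vX[OF v]] M b0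
        by (intro sum_mono order_trans[OF convolution_mem_norm(2)[OF summ vX[OF v]] mult_left_mono]) auto
      also have "\<dots> \<le> C * M" unfolding C_def using M0 by (simp add: sum_distrib_right distrib_right)
      finally show ?thesis .
    qed
  qed
  obtain l w where w: "w n = 1" "w 0 = 0" "\<And>i. i < n \<Longrightarrow> w i = l * w (Suc i) - c (Suc i)"
    using companion_left_eigenvector[OF n, of c] by metis
  have eig: "(\<Sum>i=1..n. w i * ?A v i 0) = l * (\<Sum>i=1..n. w i * v i 0)" if v: "v \<in> {1..n} \<rightarrow>\<^sub>E X" for v
  proof -
    have "(\<Sum>i=1..n. w i * ?A v i 0) = (\<Sum>i=1..n. w i * (if i < n then v (i + 1) 0 else \<Sum>j=1..n. c j * v j 0))"
      by (intro sum.cong) (simp_all add: A[OF v] convolution_def c_def)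
    then show ?thesis using companion_functional_step[OF n w, of "\<lambda>i. v i 0"] by simp
  qed
  show ?thesis
    by (rule no_dense_orbit_if_eigenfunctional[of n ?A C w l n, OF mem bound eig _ _ u])
       (use n w in auto)
qed

theorem theorem5p1:
  fixes X :: "cseq set" and N :: "cseq \<Rightarrow> real"
    and n m :: nat and a :: "nat \<Rightarrow> nat \<Rightarrow> complex" and h :: real
  assumes "(\<exists>p\<ge>1. X = lp_space p \<and> N = lp_norm p) \<or> (X = c0_space \<and> N = c0_norm)"
    and "n \<ge> 1" and "m \<ge> 1"
    and "h > 0"
    and "{z. poly (q_poly n m a) z = 0} \<subseteq> - cball (of_real (1 / h)) (1 / h)"
  shows "\<not> devaney_chaotic (power_topology n X N) (exp_semigroup n X N (A_minus X N n m a h))"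
proof -
  interpret sequence_space X N
    using assms(1) sequence_space_lp sequence_space_c0 by blast
  show ?thesis
    using backward_semidiscretization_no_dense_orbit[OF assms(2,4,5)]
    unfolding devaney_chaotic_def topspace_power by blast
qed

end
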